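(* Let $\mathrm U_e:\mathbf{ERD}\to\mathbf{RD}$ be the inclusion and $\mathrm E:\mathbf{RD}\to\mathbf{ERD}$, $R\mapsto R^e$, the extensional collapse 2-functor. Then $\mathrm E\dashv\mathrm U_e$ is a (strict) 2-adjunction. That is, for every relational doctrine $R$ and every extensional relational doctrine $S$, the functor $$-\circ C^R:\ \mathbf{ERD}(R^e,S)\longrightarrow\mathbf{RD}(R,S)$$ is an equivalence.
   Context: $\mathbf{Pos}$ is the category of posets and monotone maps. A relational doctrine consists of a category $\mathcal C$ (its base); a functor $R:(\mathcal C\times\mathcal C)^{op}\to\mathbf{Pos}$ (for $f:X\to A$, $g:Y\to B$ write $R_{f,g}:R(A,B)\to R(X,Y)$); elements $d_X\in R(X,X)$ with $d_X\le R_{f,f}(d_Y)$ for all $f:X\to Y$; monotone maps $;:R(X,Y)\times R(Y,Z)\to R(X,Z)$ with $R_{f,g}(\alpha);R_{g,h}(\beta)\le R_{f,h}(\alpha;\beta)$; monotone maps $(-)^\bot:R(X,Y)\to R(Y,X)$ with $(R_{f,g}(\alpha))^\bot\le R_{g,f}(\alpha^\bot)$; such that $;$ is associative with units $d$, $(\alpha;\beta)^\bot=\beta^\bot;\alpha^\bot$, $d_X^\bot=d_X$, $\alpha^{\bot\bot}=\alpha$. The 2-category $\mathbf{RD}$: objects are relational doctrines; a 1-arrow $F:R\to S$ (bases $\mathcal C,\mathcal D$) is a pair of a functor $\widehat F:\mathcal C\to\mathcal D$ and a natural transformation with components $\overline F_{X,Y}:R(X,Y)\to S(\widehat FX,\widehat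 FY)$ strictly preserving $d$, $;$ and $(-)^\bot$; a 2-arrow $\theta:F\Rightarrow G$ is a natural transformation $\theta:\widehat F\to\widehat G$ with $\overline F_{X,Y}(\alpha)\le S_{\theta_X,\theta_Y}(\overline G_{X,Y}(\alpha))$. For parallel arrows $f,g:X\to Y$ in the base of $R$, write $f\approx g$ if $d_X\le R_{f,g}(d_Y)$. $R$ is extensional if $f\approx g$ implies $f=g$. $\mathbf{ERD}$ is the full sub-2-category of $\mathbf{RD}$ on extensional relational doctrines. The relation $\approx$ is a congruence on the base $\mathcal C$ of $R$. The extensional collapse $R^e$ of $R$ has base $\mathcal C/\!\approx$ (same objects, arrows are $\approx$-classes $[f]$), $R^e(X,Y)=R(X,Y)$, $R^e_{[f],[g]}=R_{f,g}$, and the relational operations of $R$. On 1-arrows, $\mathrm E(F)=F^e$ with $\widehat{F^e}X=\widehat FX$, $\widehat{F^e}[f]=[\widehat Ff]$, $\overline{F^e}=\overline F$; on 2-arrows $\theta^e_X=[\theta_X]$. The 1-arrow $C^R:R\to R^e$ has $\widehat{C^R}X=X$, $\widehat{C^R}f=[f]$, and $\overline{C^R}$ the identity. *)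

theory Defs
  imports "HOL-Library.FuncSet"
begin

section \<open>Categories and functors\<close>

text \<open>
  A category is given by carrier sets of objects and arrows inside arbitrary types;
  \<open>cmp C g f\<close> is the composite of \<open>f\<close> followed by \<open>g\<close>.  Only the values of
  the operations on the carriers are meaningful.
\<close>

record ('o, 'a) cat =
  obj :: "'o set"
  arr :: "'a set"
  src :: "'a \<Rightarrow> 'o"
  tgt :: "'a \<Rightarrow> 'o"
  ide :: "'o \<Rightarrow> 'a"
  cmp :: "'a \<Rightarrow> 'a \<Rightarrow> 'a"

definition hom :: "('o, 'a, 'z) cat_scheme \<Rightarrow> 'o \<Rightarrow> 'o \<Rightarrow> 'a set" where
  "hom C X Y = {f \<in> arr C. src C f = X \<and> tgt C f = Y}"

locale category =
  fixes C :: "('o, 'a) cat"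
  assumes src_obj: "f \<in> arr C \<Longrightarrow> src C f \<in> obj C"
    and tgt_obj: "f \<in> arr C \<Longrightarrow> tgt C f \<in> obj C"
    and ide_hom: "X \<in> obj C \<Longrightarrow> ide C X \<in> hom C X X"
    and cmp_hom: "\<lbrakk>f \<in> hom C X Y; g \<in> hom C Y Z\<rbrakk> \<Longrightarrow> cmp C g f \<in> hom C X Z"
    and cmp_ide_left: "f \<in> hom C X Y \<Longrightarrow> cmp C (ide C Y) f = f"
    and cmp_ide_right: "f \<in> hom C X Y \<Longrightarrow> cmp C f (ide C X) = f"
    and cmp_assoc: "\<lbrakk>f \<in> hom C X Y; g \<in> hom C Y Z; h \<in> hom C Z W\<rbrakk>
      \<Longrightarrow> cmp C h (cmp C g f) = cmp C (cmp C h g) f"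

record ('o, 'a, 'p, 'b) cfun =
  fob :: "'o \<Rightarrow> 'p"
  far :: "'a \<Rightarrow> 'b"

locale cfunctor = C: category C + D: category D
  for C :: "('o, 'a) cat" and D :: "('p, 'b) cat" +
  fixes F :: "('o, 'a, 'p, 'b) cfun"
  assumes fob_obj: "X \<in> obj C \<Longrightarrow> fob F X \<in> obj D"
    and far_hom: "f \<in> hom C X Y \<Longrightarrow> far F f \<in> hom D (fob F X) (fob F Y)"
    and far_ide: "X \<in> obj C \<Longrightarrow> far F (ide C X) = ide D (fob F X)"
    and far_cmp: "\<lbrakk>f \<in> hom C X Y; g \<in> hom C Y Z\<rbrakk>
      \<Longrightarrow> far F (cmp C g f) = cmp D (far F g) (far F f)"

definition id_cfun :: "('o, 'a, 'o, 'a) cfun" where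
  "id_cfun = \<lparr>fob = (\<lambda>X. X), far = (\<lambda>f. f)\<rparr>"

definition comp_cfun ::
  "('p, 'b, 'q, 'c) cfun \<Rightarrow> ('o, 'a, 'p, 'b) cfun \<Rightarrow> ('o, 'a, 'q, 'c) cfun" where
  "comp_cfun G F = \<lparr>fob = fob G \<circ> fob F, far = far G \<circ> far F\<rparr>"

definition nat_trans ::
  "('o, 'a) cat \<Rightarrow> ('p, 'b) cat \<Rightarrow> ('o, 'a, 'p, 'b) cfun \<Rightarrow> ('o, 'a, 'p, 'b) cfun
    \<Rightarrow> ('o \<Rightarrow> 'b) \<Rightarrow> bool" where
  "nat_trans C D F G t \<longleftrightarrow>
     (\<forall>X \<in> obj C. t X \<in> hom D (fob F X) (fob G X)) \<and>
     (\<forall>f \<in> arr C. cmp D (t (tgt C f)) (far F f) = cmp D (far G f) (t (src C f)))"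

definition iso_arrow :: "('o, 'a) cat \<Rightarrow> 'a \<Rightarrow> bool" where
  "iso_arrow C f \<longleftrightarrow> f \<in> arr C \<and>
     (\<exists>g \<in> hom C (tgt C f) (src C f).
        cmp C g f = ide C (src C f) \<and> cmp C f g = ide C (tgt C f))"

definition nat_iso ::
  "('o, 'a) cat \<Rightarrow> ('p, 'b) cat \<Rightarrow> ('o, 'a, 'p, 'b) cfun \<Rightarrow> ('o, 'a, 'p, 'b) cfun
    \<Rightarrow> ('o \<Rightarrow> 'b) \<Rightarrow> bool" where
  "nat_iso C D F G t \<longleftrightarrow> nat_trans C D F G t \<and> (\<forall>X \<in> obj C. iso_arrow D (t X))"

definition equivalence_of_categories ::
  "('o, 'a) cat \<Rightarrow> ('p, 'b) cat \<Rightarrow> ('o, 'a, 'p, 'b) cfun \<Rightarrow> bool" where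
  "equivalence_of_categories C D F \<longleftrightarrow> cfunctor C D F \<and>
     (\<exists>G. cfunctor D C G \<and>
        (\<exists>\<eta>. nat_iso C C id_cfun (comp_cfun G F) \<eta>) \<and>
        (\<exists>\<epsilon>. nat_iso D D (comp_cfun F G) id_cfun \<epsilon>))"

definition isomorphism_of_categories ::
  "('o, 'a) cat \<Rightarrow> ('p, 'b) cat \<Rightarrow> ('o, 'a, 'p, 'b) cfun \<Rightarrow> bool" where
  "isomorphism_of_categories C D F \<longleftrightarrow> cfunctor C D F \<and>
     (\<exists>G. cfunctor D C G \<and>
        (\<forall>X \<in> obj C. fob G (fob F X) = X) \<and> (\<forall>f \<in> arr C. far G (far F f) = f) \<and>
        (\<forall>Y \<in> obj D. fob F (fob G Y) = Y) \<and> (\<forall>g \<in> arr D. far F (far G g) = g))"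

section \<open>Relational doctrines\<close>

text \<open>
  \<open>rel R X Y\<close> with the order \<open>le R X Y\<close> is the poset $R(X,Y)$;
  \<open>reidx R f g\<close> is $R_{f,g}$; \<open>diag R X\<close> is $d_X$; \<open>seq R X Y Z \<alpha> \<beta>\<close>
  is $\alpha;\beta$ for $\alpha \in R(X,Y)$, $\beta \in R(Y,Z)$; and
  \<open>conv R X Y \<alpha>\<close> is $\alpha^\bot$ for $\alpha \in R(X,Y)$.
\<close>

record ('o, 'a, 'r) doctrine =
  base :: "('o, 'a) cat"
  rel :: "'o \<Rightarrow> 'o \<Rightarrow> 'r set"
  le :: "'o \<Rightarrow> 'o \<Rightarrow> 'r \<Rightarrow> 'r \<Rightarrow> bool"
  reidx :: "'a \<Rightarrow> 'a \<Rightarrow> 'r \<Rightarrow> 'r"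
  diag :: "'o \<Rightarrow> 'r"
  seq :: "'o \<Rightarrow> 'o \<Rightarrow> 'o \<Rightarrow> 'r \<Rightarrow> 'r \<Rightarrow> 'r"
  conv :: "'o \<Rightarrow> 'o \<Rightarrow> 'r \<Rightarrow> 'r"

abbreviation Ob :: "('o, 'a, 'r) doctrine \<Rightarrow> 'o set" where
  "Ob R \<equiv> obj (base R)"

abbreviation Hom :: "('o, 'a, 'r) doctrine \<Rightarrow> 'o \<Rightarrow> 'o \<Rightarrow> 'a set" where
  "Hom R \<equiv> hom (base R)"

locale relational_doctrine =
  fixes R :: "('o, 'a, 'r) doctrine"
  assumes base_category: "category (base R)"
    and le_refl: "\<lbrakk>X \<in> Ob R; Y \<in> Ob R; \<alpha> \<in> rel R X Y\<rbrakk> \<Longrightarrow> le R X Y \<alpha> \<alpha>"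
    and le_antisym: "\<lbrakk>X \<in> Ob R; Y \<in> Ob R; \<alpha> \<in> rel R X Y; \<beta> \<in> rel R X Y;
        le R X Y \<alpha> \<beta>; le R X Y \<beta> \<alpha>\<rbrakk> \<Longrightarrow> \<alpha> = \<beta>"
    and le_trans: "\<lbrakk>X \<in> Ob R; Y \<in> Ob R; \<alpha> \<in> rel R X Y; \<beta> \<in> rel R X Y; \<gamma> \<in> rel R X Y;
        le R X Y \<alpha> \<beta>; le R X Y \<beta> \<gamma>\<rbrakk> \<Longrightarrow> le R X Y \<alpha> \<gamma>"
    and reidx_rel: "\<lbrakk>f \<in> Hom R X A; g \<in> Hom R Y B; \<alpha> \<in> rel R A B\<rbrakk>
        \<Longrightarrow> reidx R f g \<alpha> \<in> rel R X Y"
    and reidx_mono: "\<lbrakk>f \<in> Hom R X A; g \<in> Hom R Y B; \<alpha> \<in> rel R A B; \<beta> \<in> rel R A B;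
        le R A B \<alpha> \<beta>\<rbrakk> \<Longrightarrow> le R X Y (reidx R f g \<alpha>) (reidx R f g \<beta>)"
    and reidx_ide: "\<lbrakk>X \<in> Ob R; Y \<in> Ob R; \<alpha> \<in> rel R X Y\<rbrakk>
        \<Longrightarrow> reidx R (ide (base R) X) (ide (base R) Y) \<alpha> = \<alpha>"
    and reidx_cmp: "\<lbrakk>f' \<in> Hom R X' X; f \<in> Hom R X A; g' \<in> Hom R Y' Y; g \<in> Hom R Y B;
        \<alpha> \<in> rel R A B\<rbrakk>
        \<Longrightarrow> reidx R (cmp (base R) f f') (cmp (base R) g g') \<alpha> = reidx R f' g' (reidx R f g \<alpha>)"
    and diag_rel: "X \<in> Ob R \<Longrightarrow> diag R X \<in> rel R X X"
    and diag_lax: "f \<in> Hom R X Y \<Longrightarrow> le R X X (diag R X) (reidx R f f (diag R Y))"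
    and seq_rel: "\<lbrakk>X \<in> Ob R; Y \<in> Ob R; Z \<in> Ob R; \<alpha> \<in> rel R X Y; \<beta> \<in> rel R Y Z\<rbrakk>
        \<Longrightarrow> seq R X Y Z \<alpha> \<beta> \<in> rel R X Z"
    and seq_mono: "\<lbrakk>X \<in> Ob R; Y \<in> Ob R; Z \<in> Ob R; \<alpha> \<in> rel R X Y; \<alpha>' \<in> rel R X Y;
        \<beta> \<in> rel R Y Z; \<beta>' \<in> rel R Y Z; le R X Y \<alpha> \<alpha>'; le R Y Z \<beta> \<beta>'\<rbrakk>
        \<Longrightarrow> le R X Z (seq R X Y Z \<alpha> \<beta>) (seq R X Y Z \<alpha>' \<beta>')"
    and seq_lax: "\<lbrakk>f \<in> Hom R X A; g \<in> Hom R Y B; h \<in> Hom R Z D; \<alpha> \<in> rel R A B; \<beta> \<in> rel R B D\<rbrakk>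
        \<Longrightarrow> le R X Z (seq R X Y Z (reidx R f g \<alpha>) (reidx R g h \<beta>))
                        (reidx R f h (seq R A B D \<alpha> \<beta>))"
    and conv_rel: "\<lbrakk>X \<in> Ob R; Y \<in> Ob R; \<alpha> \<in> rel R X Y\<rbrakk> \<Longrightarrow> conv R X Y \<alpha> \<in> rel R Y X"
    and conv_mono: "\<lbrakk>X \<in> Ob R; Y \<in> Ob R; \<alpha> \<in> rel R X Y; \<beta> \<in> rel R X Y; le R X Y \<alpha> \<beta>\<rbrakk>
        \<Longrightarrow> le R Y X (conv R X Y \<alpha>) (conv R X Y \<beta>)"
    and conv_lax: "\<lbrakk>f \<in> Hom R X A; g \<in> Hom R Y B; \<alpha> \<in> rel R A B\<rbrakk>
        \<Longrightarrow> le R Y X (conv R X Y (reidx R f g \<alpha>)) (reidx R g f (conv R A B \<alpha>))"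
    and seq_assoc: "\<lbrakk>X \<in> Ob R; Y \<in> Ob R; Z \<in> Ob R; W \<in> Ob R;
        \<alpha> \<in> rel R X Y; \<beta> \<in> rel R Y Z; \<gamma> \<in> rel R Z W\<rbrakk>
        \<Longrightarrow> seq R X Z W (seq R X Y Z \<alpha> \<beta>) \<gamma> = seq R X Y W \<alpha> (seq R Y Z W \<beta> \<gamma>)"
    and seq_diag_left: "\<lbrakk>X \<in> Ob R; Y \<in> Ob R; \<alpha> \<in> rel R X Y\<rbrakk> \<Longrightarrow> seq R X X Y (diag R X) \<alpha> = \<alpha>"
    and seq_diag_right: "\<lbrakk>X \<in> Ob R; Y \<in> Ob R; \<alpha> \<in> rel R X Y\<rbrakk> \<Longrightarrow> seq R X Y Y \<alpha> (diag R Y) = \<alpha>"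
    and conv_seq: "\<lbrakk>X \<in> Ob R; Y \<in> Ob R; Z \<in> Ob R; \<alpha> \<in> rel R X Y; \<beta> \<in> rel R Y Z\<rbrakk>
        \<Longrightarrow> conv R X Z (seq R X Y Z \<alpha> \<beta>) = seq R Z Y X (conv R Y Z \<beta>) (conv R X Y \<alpha>)"
    and conv_diag: "X \<in> Ob R \<Longrightarrow> conv R X X (diag R X) = diag R X"
    and conv_conv: "\<lbrakk>X \<in> Ob R; Y \<in> Ob R; \<alpha> \<in> rel R X Y\<rbrakk>
        \<Longrightarrow> conv R Y X (conv R X Y \<alpha>) = \<alpha>"

definition approx :: "('o, 'a, 'r) doctrine \<Rightarrow> 'a \<Rightarrow> 'a \<Rightarrow> bool" where
  "approx R f g \<longleftrightarrow> (\<exists>X Y. f \<in> Hom R X Y \<and> g \<in> Hom R X Y \<and>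
     le R X X (diag R X) (reidx R f g (diag R Y)))"

definition extensional_doctrine :: "('o, 'a, 'r) doctrine \<Rightarrow> bool" where
  "extensional_doctrine R \<longleftrightarrow> relational_doctrine R \<and> (\<forall>f g. approx R f g \<longrightarrow> f = g)"

section \<open>The 2-category of relational doctrines\<close>

text \<open>
  The source and target of a 1-arrow may have different carrier types, so the 2-category
  structure is given polymorphically: a hom-category \<open>RD R S\<close> for every pair of doctrines,
  and composition operations between them.  All maps are required to be \<open>undefined\<close> off
  their domains, so that equality of 1- and 2-arrows is equality of the underlying
  set-theoretic data.
\<close>

record ('o, 'a, 'r, 'p, 'b, 's) one_arrow =
  bfun :: "('o, 'a, 'p, 'b) cfun"
  rmap :: "'o \<Rightarrow> 'o \<Rightarrow> 'r \<Rightarrow> 's"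

record ('o, 'a, 'r, 'p, 'b, 's) two_arrow =
  dom1 :: "('o, 'a, 'r, 'p, 'b, 's) one_arrow"
  cod1 :: "('o, 'a, 'r, 'p, 'b, 's) one_arrow"
  cpt :: "'o \<Rightarrow> 'b"

abbreviation ob1 :: "('o, 'a, 'r, 'p, 'b, 's) one_arrow \<Rightarrow> 'o \<Rightarrow> 'p" where
  "ob1 F \<equiv> fob (bfun F)"

abbreviation ar1 :: "('o, 'a, 'r, 'p, 'b, 's) one_arrow \<Rightarrow> 'a \<Rightarrow> 'b" where
  "ar1 F \<equiv> far (bfun F)"

definition rdom :: "('o, 'a, 'r) doctrine \<Rightarrow> 'o \<Rightarrow> 'o \<Rightarrow> 'r set" where
  "rdom R X Y = {\<alpha>. X \<in> Ob R \<and> Y \<in> Ob R \<and> \<alpha> \<in> rel R X Y}"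

locale is_one_arrow =
  fixes R :: "('o, 'a, 'r) doctrine" and S :: "('p, 'b, 's) doctrine"
    and F :: "('o, 'a, 'r, 'p, 'b, 's) one_arrow"
  assumes base_functor: "cfunctor (base R) (base S) (bfun F)"
    and ob1_extensional: "ob1 F \<in> extensional (Ob R)"
    and ar1_extensional: "ar1 F \<in> extensional (arr (base R))"
    and rmap_extensional: "rmap F X Y \<in> extensional (rdom R X Y)"
    and rmap_rel: "\<lbrakk>X \<in> Ob R; Y \<in> Ob R; \<alpha> \<in> rel R X Y\<rbrakk>
        \<Longrightarrow> rmap F X Y \<alpha> \<in> rel S (ob1 F X) (ob1 F Y)"
    and rmap_mono: "\<lbrakk>X \<in> Ob R; Y \<in> Ob R; \<alpha> \<in> rel R X Y; \<beta> \<in> rel R X Y; le R X Y \<alpha> \<beta>\<rbrakk>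
        \<Longrightarrow> le S (ob1 F X) (ob1 F Y) (rmap F X Y \<alpha>) (rmap F X Y \<beta>)"
    and rmap_natural: "\<lbrakk>f \<in> Hom R X A; g \<in> Hom R Y B; \<alpha> \<in> rel R A B\<rbrakk>
        \<Longrightarrow> rmap F X Y (reidx R f g \<alpha>) = reidx S (ar1 F f) (ar1 F g) (rmap F A B \<alpha>)"
    and rmap_diag: "X \<in> Ob R \<Longrightarrow> rmap F X X (diag R X) = diag S (ob1 F X)"
    and rmap_seq: "\<lbrakk>X \<in> Ob R; Y \<in> Ob R; Z \<in> Ob R; \<alpha> \<in> rel R X Y; \<beta> \<in> rel R Y Z\<rbrakk>
        \<Longrightarrow> rmap F X Z (seq R X Y Z \<alpha> \<beta>)
          = seq S (ob1 F X) (ob1 F Y) (ob1 F Z) (rmap F X Y \<alpha>) (rmap F Y Z \<beta>)"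
    and rmap_conv: "\<lbrakk>X \<in> Ob R; Y \<in> Ob R; \<alpha> \<in> rel R X Y\<rbrakk>
        \<Longrightarrow> rmap F Y X (conv R X Y \<alpha>) = conv S (ob1 F X) (ob1 F Y) (rmap F X Y \<alpha>)"

locale is_two_arrow =
  fixes R :: "('o, 'a, 'r) doctrine" and S :: "('p, 'b, 's) doctrine"
    and \<theta> :: "('o, 'a, 'r, 'p, 'b, 's) two_arrow"
  assumes dom1_one_arrow: "is_one_arrow R S (dom1 \<theta>)"
    and cod1_one_arrow: "is_one_arrow R S (cod1 \<theta>)"
    and cpt_extensional: "cpt \<theta> \<in> extensional (Ob R)"
    and cpt_natural: "nat_trans (base R) (base S) (bfun (dom1 \<theta>)) (bfun (cod1 \<theta>)) (cpt \<theta>)"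
    and cpt_le: "\<lbrakk>X \<in> Ob R; Y \<in> Ob R; \<alpha> \<in> rel R X Y\<rbrakk>
        \<Longrightarrow> le S (ob1 (dom1 \<theta>) X) (ob1 (dom1 \<theta>) Y) (rmap (dom1 \<theta>) X Y \<alpha>)
              (reidx S (cpt \<theta> X) (cpt \<theta> Y) (rmap (cod1 \<theta>) X Y \<alpha>))"

definition id1 :: "('o, 'a, 'r) doctrine \<Rightarrow> ('o, 'a, 'r, 'o, 'a, 'r) one_arrow" where
  "id1 R = \<lparr>bfun = \<lparr>fob = (\<lambda>X \<in> Ob R. X), far = (\<lambda>f \<in> arr (base R). f)\<rparr>,
            rmap = (\<lambda>X Y. \<lambda>\<alpha> \<in> rdom R X Y. \<alpha>)\<rparr>"

text \<open>\<open>comp1 R G F\<close> is the composite of $F : R \to S$ followed by $G : S \to T$.\<close>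

definition comp1 ::
  "('o, 'a, 'r) doctrine \<Rightarrow> ('p, 'b, 's, 'q, 'c, 't) one_arrow
    \<Rightarrow> ('o, 'a, 'r, 'p, 'b, 's) one_arrow \<Rightarrow> ('o, 'a, 'r, 'q, 'c, 't) one_arrow" where
  "comp1 R G F = \<lparr>bfun = \<lparr>fob = (\<lambda>X \<in> Ob R. ob1 G (ob1 F X)),
                          far = (\<lambda>f \<in> arr (base R). ar1 G (ar1 F f))\<rparr>,
                  rmap = (\<lambda>X Y. \<lambda>\<alpha> \<in> rdom R X Y. rmap G (ob1 F X) (ob1 F Y) (rmap F X Y \<alpha>))\<rparr>"

definition id2 ::
  "('o, 'a, 'r) doctrine \<Rightarrow> ('p, 'b, 's) doctrine \<Rightarrow> ('o, 'a, 'r, 'p, 'b, 's) one_arrow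
    \<Rightarrow> ('o, 'a, 'r, 'p, 'b, 's) two_arrow" where
  "id2 R S F = \<lparr>dom1 = F, cod1 = F, cpt = (\<lambda>X \<in> Ob R. ide (base S) (ob1 F X))\<rparr>"

definition vcomp ::
  "('o, 'a, 'r) doctrine \<Rightarrow> ('p, 'b, 's) doctrine \<Rightarrow> ('o, 'a, 'r, 'p, 'b, 's) two_arrow
    \<Rightarrow> ('o, 'a, 'r, 'p, 'b, 's) two_arrow \<Rightarrow> ('o, 'a, 'r, 'p, 'b, 's) two_arrow" where
  "vcomp R S \<psi> \<theta> = \<lparr>dom1 = dom1 \<theta>, cod1 = cod1 \<psi>,
                    cpt = (\<lambda>X \<in> Ob R. cmp (base S) (cpt \<psi> X) (cpt \<theta> X))\<rparr>"

text \<open>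
  \<open>hcomp R T \<psi> \<theta>\<close> is the horizontal composite of $\theta : F \Rightarrow F' : R \to S$
  and $\psi : G \Rightarrow G' : S \to T$, with components
  $\psi_{F'X} \circ \widehat G(\theta_X)$.
\<close>

definition hcomp ::
  "('o, 'a, 'r) doctrine \<Rightarrow> ('q, 'c, 't) doctrine \<Rightarrow> ('p, 'b, 's, 'q, 'c, 't) two_arrow
    \<Rightarrow> ('o, 'a, 'r, 'p, 'b, 's) two_arrow \<Rightarrow> ('o, 'a, 'r, 'q, 'c, 't) two_arrow" where
  "hcomp R T \<psi> \<theta> =
     \<lparr>dom1 = comp1 R (dom1 \<psi>) (dom1 \<theta>), cod1 = comp1 R (cod1 \<psi>) (cod1 \<theta>),
      cpt = (\<lambda>X \<in> Ob R. cmp (base T) (cpt \<psi> (ob1 (cod1 \<theta>) X)) (ar1 (dom1 \<psi>) (cpt \<theta> X)))\<rparr>"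

definition RD ::
  "('o, 'a, 'r) doctrine \<Rightarrow> ('p, 'b, 's) doctrine
    \<Rightarrow> (('o, 'a, 'r, 'p, 'b, 's) one_arrow, ('o, 'a, 'r, 'p, 'b, 's) two_arrow) cat" where
  "RD R S = \<lparr>obj = {F. is_one_arrow R S F}, arr = {\<theta>. is_two_arrow R S \<theta>},
             src = dom1, tgt = cod1, ide = id2 R S, cmp = vcomp R S\<rparr>"

text \<open>
  Extensional doctrines form a full sub-2-category: between extensional doctrines the
  hom-categories, compositions and identities are those above, and the inclusion
  $\mathrm U_e$ is the identity on all data.  \<open>ERD R S\<close> is meaningful only for
  extensional \<open>R\<close> and \<open>S\<close>.
\<close>

definition ERD ::
  "('o, 'a, 'r) doctrine \<Rightarrow> ('p, 'b, 's) doctrine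
    \<Rightarrow> (('o, 'a, 'r, 'p, 'b, 's) one_arrow, ('o, 'a, 'r, 'p, 'b, 's) two_arrow) cat" where
  "ERD R S = RD R S"

text \<open>The functor $- \circ H : \mathbf{RD}(R',S) \to \mathbf{RD}(R,S)$ for $H : R \to R'$.\<close>

definition precomp ::
  "('o, 'a, 'r) doctrine \<Rightarrow> ('p, 'b, 's) doctrine \<Rightarrow> ('q, 'c, 't) doctrine
    \<Rightarrow> ('o, 'a, 'r, 'p, 'b, 's) one_arrow
    \<Rightarrow> (('p, 'b, 's, 'q, 'c, 't) one_arrow, ('p, 'b, 's, 'q, 'c, 't) two_arrow,
        ('o, 'a, 'r, 'q, 'c, 't) one_arrow, ('o, 'a, 'r, 'q, 'c, 't) two_arrow) cfun" where
  "precomp R R' S H = \<lparr>fob = (\<lambda>F. comp1 R F H), far = (\<lambda>\<theta>. hcomp R S \<theta> (id2 R R' H))\<rparr>"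

section \<open>The extensional collapse\<close>

definition eqcls :: "('o, 'a, 'r) doctrine \<Rightarrow> 'a \<Rightarrow> 'a set" where
  "eqcls R f = {g. approx R f g}"

text \<open>
  Operations on classes are given by the common value of the operation on representatives:
  \<open>the_elem (h ` c)\<close> is the value of \<open>h\<close> on the class \<open>c\<close>, provided \<open>h\<close> is
  constant on \<open>c\<close>.
\<close>

definition quotient_cat :: "('o, 'a, 'r) doctrine \<Rightarrow> ('o, 'a set) cat" where
  "quotient_cat R =
     \<lparr>obj = Ob R,
      arr = eqcls R ` arr (base R),
      src = (\<lambda>c. the_elem (src (base R) ` c)),
      tgt = (\<lambda>c. the_elem (tgt (base R) ` c)),
      ide = (\<lambda>X. eqcls R (ide (base R) X)),
      cmp = (\<lambda>c' c. the_elem ((\<lambda>(g, f). eqcls R (cmp (base R) g f)) ` (c' \<times> c)))\<rparr>"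

definition collapse :: "('o, 'a, 'r) doctrine \<Rightarrow> ('o, 'a set, 'r) doctrine" where
  "collapse R =
     \<lparr>base = quotient_cat R,
      rel = rel R,
      le = le R,
      reidx = (\<lambda>c c' \<alpha>. the_elem ((\<lambda>(f, g). reidx R f g \<alpha>) ` (c \<times> c'))),
      diag = diag R,
      seq = seq R,
      conv = conv R\<rparr>"

definition collapse1 ::
  "('o, 'a, 'r) doctrine \<Rightarrow> ('p, 'b, 's) doctrine \<Rightarrow> ('o, 'a, 'r, 'p, 'b, 's) one_arrow
    \<Rightarrow> ('o, 'a set, 'r, 'p, 'b set, 's) one_arrow" where
  "collapse1 R S F =
     \<lparr>bfun = \<lparr>fob = ob1 F,
              far = (\<lambda>c \<in> arr (quotient_cat R). the_elem ((\<lambda>f. eqcls S (ar1 F f)) ` c))\<rparr>,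
      rmap = rmap F\<rparr>"

definition collapse2 ::
  "('o, 'a, 'r) doctrine \<Rightarrow> ('p, 'b, 's) doctrine \<Rightarrow> ('o, 'a, 'r, 'p, 'b, 's) two_arrow
    \<Rightarrow> ('o, 'a set, 'r, 'p, 'b set, 's) two_arrow" where
  "collapse2 R S \<theta> =
     \<lparr>dom1 = collapse1 R S (dom1 \<theta>), cod1 = collapse1 R S (cod1 \<theta>),
      cpt = (\<lambda>X \<in> Ob R. eqcls S (cpt \<theta> X))\<rparr>"

text \<open>The action of $\mathrm E$ on hom-categories.\<close>

definition E_hom ::
  "('o, 'a, 'r) doctrine \<Rightarrow> ('p, 'b, 's) doctrine
    \<Rightarrow> (('o, 'a, 'r, 'p, 'b, 's) one_arrow, ('o, 'a, 'r, 'p, 'b, 's) two_arrow,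
        ('o, 'a set, 'r, 'p, 'b set, 's) one_arrow,
        ('o, 'a set, 'r, 'p, 'b set, 's) two_arrow) cfun" where
  "E_hom R S = \<lparr>fob = collapse1 R S, far = collapse2 R S\<rparr>"

definition collapse_unit ::
  "('o, 'a, 'r) doctrine \<Rightarrow> ('o, 'a, 'r, 'o, 'a set, 'r) one_arrow" where
  "collapse_unit R =
     \<lparr>bfun = \<lparr>fob = (\<lambda>X \<in> Ob R. X), far = (\<lambda>f \<in> arr (base R). eqcls R f)\<rparr>,
      rmap = (\<lambda>X Y. \<lambda>\<alpha> \<in> rdom R X Y. \<alpha>)\<rparr>"

end

theory Submission
  imports Defs
begin

text \<open>
  Think of $d$ as equality and of $R_{f,g}$ as substitution of terms: $f \approx g$ says that the
  values of \<open>f\<close> and \<open>g\<close> at equal arguments are provably equal.  If $f \approx f'$ and $g \approx g'$ then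
  \[ R_{f,g}(\alpha) = d ; R_{f,g}(\alpha) ; d
       \le R_{f',f}(d) ; R_{f,g}(\alpha) ; R_{g,g'}(d) \le R_{f',g'}(d ; \alpha ; d)
       = R_{f',g'}(\alpha), \]
  so reindexing depends only on the classes of its indices (\<open>reidx_approx\<close>).  Together with the
  converse, which gives symmetry of $\approx$, this makes $R^e$ a doctrine, and an extensional one.

  A 1-arrow preserves $\approx$, because it preserves reindexing and diagonals strictly.  So a
  1-arrow from \<open>R\<close> into an extensional \<open>S\<close> is constant on classes and factors through
  $C^R : R \to R^e$.  The factor is unique since $C^R$ is the identity on objects and relations and
  surjective on arrows.  A 2-arrow is only a family of arrows indexed by objects, so the 2-arrows on
  the two sides have the same components.  Hence precomposition with $C^R$ is not just an
  equivalence but an isomorphism of hom-categories (\<open>precomp_collapse_unit_isomorphism\<close>).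

  Everything else is formal in the 2-category of doctrines.  The collapse $F^e$ is the
  factor of $C^S \circ F$ through $C^R$, so $F^e \circ C^R = C^S \circ F$, and likewise for 2-arrows.
  Functoriality of the collapse on composites follows because both sides become equal after
  precomposition with $C^R$, and naturality of the bijection follows by reassociating.
\<close>

section \<open>Categories\<close>

lemma arr_in_hom: "f \<in> arr C \<Longrightarrow> f \<in> hom C (src C f) (tgt C f)"
  by (simp add: hom_def)

lemma hom_arr: "f \<in> hom C X Y \<Longrightarrow> f \<in> arr C"
  by (simp add: hom_def)

lemma (in category) hom_objs: "f \<in> hom C X Y \<Longrightarrow> X \<in> obj C \<and> Y \<in> obj C"
  using src_obj tgt_obj by (auto simp: hom_def)

lemma nat_transI:
  assumes "\<And>X. X \<in> obj C \<Longrightarrow> t X \<in> hom D (fob F X) (fob G X)"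
    and "\<And>f X Y. f \<in> hom C X Y \<Longrightarrow> cmp D (t Y) (far F f) = cmp D (far G f) (t X)"
  shows "nat_trans C D F G t"
  using assms(1) assms(2)[OF arr_in_hom] by (auto simp: nat_trans_def)

text \<open>
  The unit and counit of the equivalence are the families of identities.
\<close>

lemma isomorphism_imp_equivalence:
  assumes "isomorphism_of_categories C D F"
  shows "equivalence_of_categories C D F"
proof -
  from assms obtain G where F: "cfunctor C D F" and G: "cfunctor D C G"
    and GF: "\<And>X. X \<in> obj C \<Longrightarrow> fob G (fob F X) = X" "\<And>f. f \<in> arr C \<Longrightarrow> far G (far F f) = f"
    and FG: "\<And>Y. Y \<in> obj D \<Longrightarrow> fob F (fob G Y) = Y" "\<And>g. g \<in> arr D \<Longrightarrow> far F (far G g) = g"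
    unfolding isomorphism_of_categories_def by blast
  interpret F: cfunctor C D F by fact
  have iso_ide: "iso_arrow A (ide A X)" if "category A" "X \<in> obj A" for A :: "('x, 'y) cat" and X
  proof -
    interpret A: category A by fact
    note i = A.ide_hom[OF that(2)]
    then have "src A (ide A X) = X" "tgt A (ide A X) = X" by (simp_all add: hom_def)
    with i A.cmp_ide_left[OF i] show ?thesis
      unfolding iso_arrow_def by (auto simp: hom_arr intro!: bexI[of _ "ide A X"])
  qed
  have "nat_iso C C id_cfun (comp_cfun G F) (ide C)"
    using F.C.ide_hom iso_ide[OF F.C.category_axioms]
    by (auto simp: nat_iso_def id_cfun_def comp_cfun_def GF F.C.hom_objs F.C.cmp_ide_left
        F.C.cmp_ide_right hom_arr intro!: nat_transI)
  moreover have "nat_iso D D (comp_cfun F G) id_cfun (ide D)"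
    using F.D.ide_hom iso_ide[OF F.D.category_axioms]
    by (auto simp: nat_iso_def id_cfun_def comp_cfun_def FG F.D.hom_objs F.D.cmp_ide_left
        F.D.cmp_ide_right hom_arr intro!: nat_transI)
  ultimately show ?thesis using F G unfolding equivalence_of_categories_def by blast
qed

section \<open>Hom-categories of relational doctrines\<close>

sublocale relational_doctrine \<subseteq> base: category "base R"
  by (rule base_category)

sublocale is_one_arrow \<subseteq> base: cfunctor "base R" "base S" "bfun F"
  by (rule base_functor)

sublocale is_two_arrow \<subseteq> dom: is_one_arrow R S "dom1 \<theta>"
  by (rule dom1_one_arrow)

sublocale is_two_arrow \<subseteq> cod: is_one_arrow R S "cod1 \<theta>"
  by (rule cod1_one_arrow)

lemma (in is_two_arrow) cpt_hom:
  "X \<in> Ob R \<Longrightarrow> cpt \<theta> X \<in> Hom S (ob1 (dom1 \<theta>) X) (ob1 (cod1 \<theta>) X)"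
  using cpt_natural by (auto simp: nat_trans_def)

lemma (in is_two_arrow) cpt_square:
  "f \<in> Hom R X Y
    \<Longrightarrow> cmp (base S) (cpt \<theta> Y) (ar1 (dom1 \<theta>) f) = cmp (base S) (ar1 (cod1 \<theta>) f) (cpt \<theta> X)"
  using cpt_natural by (auto simp: nat_trans_def hom_def)

text \<open>
  All components of a 1-arrow are \<open>undefined\<close> off their domains, so agreement on the carriers
  is equality.
\<close>

lemma one_arrow_eqI:
  fixes F G :: "('o, 'a, 'r, 'p, 'b, 's) one_arrow"
  assumes "is_one_arrow R S F" and "is_one_arrow R S G"
    and ob: "\<And>X. X \<in> Ob R \<Longrightarrow> ob1 F X = ob1 G X"
    and ar: "\<And>f X Y. f \<in> Hom R X Y \<Longrightarrow> ar1 F f = ar1 G f"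
    and rmap: "\<And>X Y \<alpha>. \<lbrakk>X \<in> Ob R; Y \<in> Ob R; \<alpha> \<in> rel R X Y\<rbrakk> \<Longrightarrow> rmap F X Y \<alpha> = rmap G X Y \<alpha>"
  shows "F = G"
proof -
  interpret F: is_one_arrow R S F by fact
  interpret G: is_one_arrow R S G by fact
  have "ob1 F = ob1 G"
    by (rule extensionalityI[OF F.ob1_extensional G.ob1_extensional]) (rule ob)
  moreover have "ar1 F = ar1 G"
    by (rule extensionalityI[OF F.ar1_extensional G.ar1_extensional]) (rule ar[OF arr_in_hom])
  moreover have "rmap F X Y = rmap G X Y" for X Y
    by (rule extensionalityI[OF F.rmap_extensional G.rmap_extensional])
      (auto simp: rdom_def intro: rmap)
  ultimately show ?thesis by (auto intro!: one_arrow.equality cfun.equality)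
qed

lemma two_arrow_eqI:
  fixes \<theta> \<psi> :: "('o, 'a, 'r, 'p, 'b, 's) two_arrow"
  assumes "is_two_arrow R S \<theta>" and "is_two_arrow R S \<psi>"
    and "dom1 \<theta> = dom1 \<psi>" and "cod1 \<theta> = cod1 \<psi>"
    and "\<And>X. X \<in> Ob R \<Longrightarrow> cpt \<theta> X = cpt \<psi> X"
  shows "\<theta> = \<psi>"
proof -
  have "cpt \<theta> = cpt \<psi>"
    using assms by (intro extensionalityI[where A = "Ob R"]) (auto simp: is_two_arrow_def)
  with assms show ?thesis by simp
qed

lemma RD_simps [simp]:
  "obj (RD R S) = Collect (is_one_arrow R S)"
  "arr (RD R S) = Collect (is_two_arrow R S)"
  "src (RD R S) = dom1"
  "tgt (RD R S) = cod1"
  "ide (RD R S) = id2 R S"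
  "cmp (RD R S) = vcomp R S"
  by (auto simp: RD_def)

lemma id2_simps [simp]:
  "dom1 (id2 R S F) = F"
  "cod1 (id2 R S F) = F"
  "X \<in> Ob R \<Longrightarrow> cpt (id2 R S F) X = ide (base S) (ob1 F X)"
  by (auto simp: id2_def)

lemma vcomp_simps [simp]:
  "dom1 (vcomp R S \<psi> \<theta>) = dom1 \<theta>"
  "cod1 (vcomp R S \<psi> \<theta>) = cod1 \<psi>"
  "X \<in> Ob R \<Longrightarrow> cpt (vcomp R S \<psi> \<theta>) X = cmp (base S) (cpt \<psi> X) (cpt \<theta> X)"
  by (auto simp: vcomp_def)

lemma id2_two_arrow:
  assumes S: "relational_doctrine S" and F: "is_one_arrow R S F"
  shows "is_two_arrow R S (id2 R S F)"
proof -
  interpret S: relational_doctrine S by fact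
  interpret F: is_one_arrow R S F by fact
  show ?thesis
  proof (rule is_two_arrow.intro)
    show "cpt (id2 R S F) \<in> extensional (Ob R)" by (simp add: id2_def)
    show "nat_trans (base R) (base S) (bfun (dom1 (id2 R S F))) (bfun (cod1 (id2 R S F)))
        (cpt (id2 R S F))"
    proof (rule nat_transI, goal_cases)
      case (1 X)
      then show ?case by (simp add: F.base.fob_obj S.base.ide_hom)
    next
      case (2 f X Y)
      with F.base.C.hom_objs[OF 2] show ?case
        by (simp add: S.base.cmp_ide_left[OF F.base.far_hom] S.base.cmp_ide_right[OF F.base.far_hom])
    qed
  qed (auto simp: F S.reidx_ide F.base.fob_obj F.rmap_rel intro!: S.le_refl)
qed

text \<open>
  For $\theta : F \Rightarrow G$ and $\psi : G \Rightarrow H$, the inequality for the composite comes from pasting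
  $\overline F(\alpha) \le S_{\theta,\theta}(\overline G(\alpha)) \le
  S_{\theta,\theta}(S_{\psi,\psi}(\overline H(\alpha)))$ and functoriality of reindexing.
\<close>

lemma vcomp_two_arrow:
  assumes S: "relational_doctrine S"
    and "is_two_arrow R S \<theta>" and "is_two_arrow R S \<psi>" and c: "cod1 \<theta> = dom1 \<psi>"
  shows "is_two_arrow R S (vcomp R S \<psi> \<theta>)"
proof -
  interpret S: relational_doctrine S by fact
  interpret \<theta>: is_two_arrow R S \<theta> by fact
  interpret \<psi>: is_two_arrow R S \<psi> by fact
  note \<theta>h = \<theta>.cpt_hom[unfolded c]
  show ?thesis
  proof (rule is_two_arrow.intro)
    show "cpt (vcomp R S \<psi> \<theta>) \<in> extensional (Ob R)" by (simp add: vcomp_def)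
    show "nat_trans (base R) (base S) (bfun (dom1 (vcomp R S \<psi> \<theta>)))
        (bfun (cod1 (vcomp R S \<psi> \<theta>))) (cpt (vcomp R S \<psi> \<theta>))"
    proof (rule nat_transI, goal_cases)
      case (1 X)
      then show ?case by (simp add: S.base.cmp_hom[OF \<theta>h \<psi>.cpt_hom])
    next
      case (2 f X Y)
      with \<theta>.dom.base.C.hom_objs have X: "X \<in> Ob R" and Y: "Y \<in> Ob R" by auto
      have "cmp (base S) (cmp (base S) (cpt \<psi> Y) (cpt \<theta> Y)) (ar1 (dom1 \<theta>) f)
          = cmp (base S) (cpt \<psi> Y) (cmp (base S) (cpt \<theta> Y) (ar1 (dom1 \<theta>) f))"
        by (rule S.base.cmp_assoc[OF \<theta>.dom.base.far_hom[OF 2] \<theta>h[OF Y] \<psi>.cpt_hom[OF Y], symmetric])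
      also have "\<dots> = cmp (base S) (cpt \<psi> Y) (cmp (base S) (ar1 (dom1 \<psi>) f) (cpt \<theta> X))"
        using \<theta>.cpt_square[OF 2] c by simp
      also have "\<dots> = cmp (base S) (cmp (base S) (cpt \<psi> Y) (ar1 (dom1 \<psi>) f)) (cpt \<theta> X)"
        by (rule S.base.cmp_assoc[OF \<theta>h[OF X] \<psi>.dom.base.far_hom[OF 2] \<psi>.cpt_hom[OF Y]])
      also have "\<dots> = cmp (base S) (cmp (base S) (ar1 (cod1 \<psi>) f) (cpt \<psi> X)) (cpt \<theta> X)"
        using \<psi>.cpt_square[OF 2] by simp
      also have "\<dots> = cmp (base S) (ar1 (cod1 \<psi>) f) (cmp (base S) (cpt \<psi> X) (cpt \<theta> X))"
        by (rule S.base.cmp_assoc[OF \<theta>h[OF X] \<psi>.cpt_hom[OF X] \<psi>.cod.base.far_hom[OF 2], symmetric])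
      finally show ?case using X Y by simp
    qed
    fix X Y \<alpha>
    assume X: "X \<in> Ob R" and Y: "Y \<in> Ob R" and \<alpha>: "\<alpha> \<in> rel R X Y"
    note obs = \<theta>.dom.base.fob_obj[OF X] \<theta>.dom.base.fob_obj[OF Y]
    note rels = \<theta>.dom.rmap_rel[OF X Y \<alpha>] \<psi>.dom.rmap_rel[OF X Y \<alpha>] \<psi>.cod.rmap_rel[OF X Y \<alpha>]
    note rel' = S.reidx_rel[OF \<psi>.cpt_hom[OF X] \<psi>.cpt_hom[OF Y] rels(3)]
    let ?L = "le S (ob1 (dom1 \<theta>) X) (ob1 (dom1 \<theta>) Y)"
    have "?L (rmap (dom1 \<theta>) X Y \<alpha>) (reidx S (cpt \<theta> X) (cpt \<theta> Y) (rmap (dom1 \<psi>) X Y \<alpha>))"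
      using \<theta>.cpt_le[OF X Y \<alpha>] c by simp
    moreover have "?L (reidx S (cpt \<theta> X) (cpt \<theta> Y) (rmap (dom1 \<psi>) X Y \<alpha>))
        (reidx S (cpt \<theta> X) (cpt \<theta> Y) (reidx S (cpt \<psi> X) (cpt \<psi> Y) (rmap (cod1 \<psi>) X Y \<alpha>)))"
      by (rule S.reidx_mono[OF \<theta>h[OF X] \<theta>h[OF Y] rels(2) rel' \<psi>.cpt_le[OF X Y \<alpha>]])
    ultimately have "?L (rmap (dom1 \<theta>) X Y \<alpha>)
        (reidx S (cpt \<theta> X) (cpt \<theta> Y) (reidx S (cpt \<psi> X) (cpt \<psi> Y) (rmap (cod1 \<psi>) X Y \<alpha>)))"
      by (rule S.le_trans[OF obs rels(1) S.reidx_rel[OF \<theta>h[OF X] \<theta>h[OF Y] rels(2)]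
          S.reidx_rel[OF \<theta>h[OF X] \<theta>h[OF Y] rel']])
    then show "le S (ob1 (dom1 (vcomp R S \<psi> \<theta>)) X) (ob1 (dom1 (vcomp R S \<psi> \<theta>)) Y)
        (rmap (dom1 (vcomp R S \<psi> \<theta>)) X Y \<alpha>)
        (reidx S (cpt (vcomp R S \<psi> \<theta>) X) (cpt (vcomp R S \<psi> \<theta>) Y)
          (rmap (cod1 (vcomp R S \<psi> \<theta>)) X Y \<alpha>))"
      using X Y by (simp add: S.reidx_cmp[OF \<theta>h[OF X] \<psi>.cpt_hom[OF X] \<theta>h[OF Y] \<psi>.cpt_hom[OF Y] rels(3)])
  qed (simp_all add: \<theta>.dom1_one_arrow \<psi>.cod1_one_arrow)
qed

lemma RD_category:
  assumes S: "relational_doctrine S"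
  shows "category (RD R S)"
proof -
  interpret S: relational_doctrine S by fact
  have comp: "is_two_arrow R S (vcomp R S \<psi> \<theta>)"
    if "is_two_arrow R S \<theta>" "is_two_arrow R S \<psi>" "cod1 \<theta> = dom1 \<psi>" for \<theta> \<psi>
    using vcomp_two_arrow[OF S that] .
  show ?thesis
  proof (standard, goal_cases)
    case 1 then show ?case by (simp add: is_two_arrow_def)
  next
    case 2 then show ?case by (simp add: is_two_arrow_def)
  next
    case 3 then show ?case by (simp add: hom_def id2_two_arrow[OF S])
  next
    case 4 then show ?case by (simp add: hom_def comp)
  next
    case (5 \<theta> F G)
    then interpret \<theta>: is_two_arrow R S \<theta> by (simp add: hom_def)
    from 5 show ?case
      by (intro two_arrow_eqI[of R S])
        (auto simp: hom_def S.base.cmp_ide_left[OF \<theta>.cpt_hom] intro!: comp id2_two_arrow[OF S]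
          \<theta>.cod1_one_arrow)
  next
    case (6 \<theta> F G)
    then interpret \<theta>: is_two_arrow R S \<theta> by (simp add: hom_def)
    from 6 show ?case
      by (intro two_arrow_eqI[of R S])
        (auto simp: hom_def S.base.cmp_ide_right[OF \<theta>.cpt_hom] intro!: comp id2_two_arrow[OF S]
          \<theta>.dom1_one_arrow)
  next
    case (7 \<theta> F G \<psi> H \<chi> K)
    then interpret \<theta>: is_two_arrow R S \<theta> by (simp add: hom_def)
    from 7 interpret \<psi>: is_two_arrow R S \<psi> by (simp add: hom_def)
    from 7 interpret \<chi>: is_two_arrow R S \<chi> by (simp add: hom_def)
    from 7 have c: "cod1 \<theta> = dom1 \<psi>" "cod1 \<psi> = dom1 \<chi>" by (simp_all add: hom_def)
    from 7 show ?case
      by (intro two_arrow_eqI[of R S])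
        (auto simp: hom_def S.base.cmp_assoc[OF \<theta>.cpt_hom[unfolded c] \<psi>.cpt_hom[unfolded c] \<chi>.cpt_hom]
          intro!: comp)
  qed
qed

section \<open>Composition of 1-arrows and horizontal composition\<close>

lemma comp1_simps [simp]:
  "X \<in> Ob R \<Longrightarrow> ob1 (comp1 R G F) X = ob1 G (ob1 F X)"
  "f \<in> arr (base R) \<Longrightarrow> ar1 (comp1 R G F) f = ar1 G (ar1 F f)"
  "\<lbrakk>X \<in> Ob R; Y \<in> Ob R; \<alpha> \<in> rel R X Y\<rbrakk>
    \<Longrightarrow> rmap (comp1 R G F) X Y \<alpha> = rmap G (ob1 F X) (ob1 F Y) (rmap F X Y \<alpha>)"
  by (auto simp: comp1_def rdom_def)

lemma hcomp_simps [simp]: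
  "dom1 (hcomp R T \<psi> \<theta>) = comp1 R (dom1 \<psi>) (dom1 \<theta>)"
  "cod1 (hcomp R T \<psi> \<theta>) = comp1 R (cod1 \<psi>) (cod1 \<theta>)"
  "X \<in> Ob R \<Longrightarrow> cpt (hcomp R T \<psi> \<theta>) X
    = cmp (base T) (cpt \<psi> (ob1 (cod1 \<theta>) X)) (ar1 (dom1 \<psi>) (cpt \<theta> X))"
  by (auto simp: hcomp_def)

lemma comp1_one_arrow:
  assumes R: "relational_doctrine R" and "is_one_arrow R S F" and "is_one_arrow S T G"
  shows "is_one_arrow R T (comp1 R G F)"
proof -
  interpret R: relational_doctrine R by fact
  interpret F: is_one_arrow R S F by fact
  interpret G: is_one_arrow S T G by fact
  note [simp] = R.base.ide_hom[THEN hom_arr] F.base.fob_obj F.rmap_rel hom_arr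
  show ?thesis
  proof
    fix X assume X: "X \<in> Ob R"
    show "ob1 (comp1 R G F) X \<in> Ob T" using X by (simp add: G.base.fob_obj)
    show "ar1 (comp1 R G F) (ide (base R) X) = ide (base T) (ob1 (comp1 R G F) X)"
      using X by (simp add: F.base.far_ide G.base.far_ide)
    show "rmap (comp1 R G F) X X (diag R X) = diag T (ob1 (comp1 R G F) X)"
      using X by (simp add: R.diag_rel F.rmap_diag G.rmap_diag)
  next
    fix f X Y assume f: "f \<in> Hom R X Y"
    show "ar1 (comp1 R G F) f \<in> Hom T (ob1 (comp1 R G F) X) (ob1 (comp1 R G F) Y)"
      using f R.base.hom_objs[OF f] G.base.far_hom[OF F.base.far_hom[OF f]] by simp
    fix g Z assume g: "g \<in> Hom R Y Z"
    show "ar1 (comp1 R G F) (cmp (base R) g f)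
        = cmp (base T) (ar1 (comp1 R G F) g) (ar1 (comp1 R G F) f)"
      using f g R.base.cmp_hom[OF f g, THEN hom_arr] F.base.far_cmp[OF f g]
        G.base.far_cmp[OF F.base.far_hom[OF f] F.base.far_hom[OF g]] by simp
  next
    fix f X A g Y B \<alpha> assume f: "f \<in> Hom R X A" and g: "g \<in> Hom R Y B" and \<alpha>: "\<alpha> \<in> rel R A B"
    show "rmap (comp1 R G F) X Y (reidx R f g \<alpha>)
        = reidx T (ar1 (comp1 R G F) f) (ar1 (comp1 R G F) g) (rmap (comp1 R G F) A B \<alpha>)"
      using f g \<alpha> R.base.hom_objs[OF f] R.base.hom_objs[OF g] R.reidx_rel[OF f g \<alpha>]
        F.rmap_natural[OF f g \<alpha>] G.rmap_natural[OF F.base.far_hom[OF f] F.base.far_hom[OF g]]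
      by simp
  next
    fix X Y Z \<alpha> \<beta>
    assume "X \<in> Ob R" "Y \<in> Ob R" "Z \<in> Ob R" "\<alpha> \<in> rel R X Y" "\<beta> \<in> rel R Y Z"
    then show "rmap (comp1 R G F) X Z (seq R X Y Z \<alpha> \<beta>)
        = seq T (ob1 (comp1 R G F) X) (ob1 (comp1 R G F) Y) (ob1 (comp1 R G F) Z)
            (rmap (comp1 R G F) X Y \<alpha>) (rmap (comp1 R G F) Y Z \<beta>)"
      by (simp add: R.seq_rel F.rmap_seq G.rmap_seq)
  qed (auto simp: comp1_def rdom_def R.conv_rel F.rmap_conv G.rmap_conv F.rmap_mono
      intro!: G.rmap_rel G.rmap_mono)
qed

text \<open>
  Let $\theta : F \Rightarrow F'$ and $\psi : G \Rightarrow G'$.  Apply $\overline G$ to the inequality of \<open>\<theta>\<close>, use naturality of $\overline G$ to turn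
  reindexing along \<open>\<theta>\<close> into reindexing along $\widehat G(\theta)$, and then use the inequality of
  \<open>\<psi>\<close> at the objects $\widehat{F'}X$ and $\widehat{F'}Y$.
\<close>

lemma hcomp_two_arrow:
  assumes R: "relational_doctrine R" and S: "relational_doctrine S" and T: "relational_doctrine T"
    and "is_two_arrow R S \<theta>" and "is_two_arrow S T \<psi>"
  shows "is_two_arrow R T (hcomp R T \<psi> \<theta>)"
proof -
  interpret T: relational_doctrine T by fact
  interpret \<theta>: is_two_arrow R S \<theta> by fact
  interpret \<psi>: is_two_arrow S T \<psi> by fact
  note obj = \<theta>.dom.base.fob_obj \<theta>.cod.base.fob_obj
  note hom1 = \<psi>.dom.base.far_hom[OF \<theta>.cpt_hom]
  note hom2 = \<psi>.cpt_hom[OF \<theta>.cod.base.fob_obj]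
  show ?thesis
  proof (rule is_two_arrow.intro)
    show "cpt (hcomp R T \<psi> \<theta>) \<in> extensional (Ob R)" by (simp add: hcomp_def)
    show "nat_trans (base R) (base T) (bfun (dom1 (hcomp R T \<psi> \<theta>)))
        (bfun (cod1 (hcomp R T \<psi> \<theta>))) (cpt (hcomp R T \<psi> \<theta>))"
    proof (rule nat_transI, goal_cases)
      case (1 X)
      then show ?case by (simp add: T.base.cmp_hom[OF hom1 hom2])
    next
      case (2 f X Y)
      with \<theta>.dom.base.C.hom_objs have X: "X \<in> Ob R" and Y: "Y \<in> Ob R" by auto
      let ?c = "cmp (base T)"
      note F = \<theta>.dom.base.far_hom[OF 2]
      note F' = \<theta>.cod.base.far_hom[OF 2]
      have "?c (?c (cpt \<psi> (ob1 (cod1 \<theta>) Y)) (ar1 (dom1 \<psi>) (cpt \<theta> Y)))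
              (ar1 (dom1 \<psi>) (ar1 (dom1 \<theta>) f))
          = ?c (cpt \<psi> (ob1 (cod1 \<theta>) Y))
              (ar1 (dom1 \<psi>) (cmp (base S) (cpt \<theta> Y) (ar1 (dom1 \<theta>) f)))"
        using T.base.cmp_assoc[OF \<psi>.dom.base.far_hom[OF F] hom1[OF Y] hom2[OF Y]]
          \<psi>.dom.base.far_cmp[OF F \<theta>.cpt_hom[OF Y]] by simp
      also have "\<dots> = ?c (?c (cpt \<psi> (ob1 (cod1 \<theta>) Y)) (ar1 (dom1 \<psi>) (ar1 (cod1 \<theta>) f)))
              (ar1 (dom1 \<psi>) (cpt \<theta> X))"
        using T.base.cmp_assoc[OF hom1[OF X] \<psi>.dom.base.far_hom[OF F'] hom2[OF Y]]
          \<psi>.dom.base.far_cmp[OF \<theta>.cpt_hom[OF X] F'] \<theta>.cpt_square[OF 2] by simp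
      also have "\<dots> = ?c (ar1 (cod1 \<psi>) (ar1 (cod1 \<theta>) f))
              (?c (cpt \<psi> (ob1 (cod1 \<theta>) X)) (ar1 (dom1 \<psi>) (cpt \<theta> X)))"
        using T.base.cmp_assoc[OF hom1[OF X] hom2[OF X] \<psi>.cod.base.far_hom[OF F']]
          \<psi>.cpt_square[OF F'] by simp
      finally show ?case using X Y 2 by (simp add: hom_arr)
    qed
    fix X Y \<alpha>
    assume X: "X \<in> Ob R" and Y: "Y \<in> Ob R" and \<alpha>: "\<alpha> \<in> rel R X Y"
    let ?F = "dom1 \<theta>" and ?F' = "cod1 \<theta>" and ?G = "dom1 \<psi>" and ?G' = "cod1 \<psi>"
    let ?G\<theta> = "\<lambda>X. ar1 ?G (cpt \<theta> X)" and ?\<psi>F = "\<lambda>X. cpt \<psi> (ob1 ?F' X)"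
    let ?L = "le T (ob1 ?G (ob1 ?F X)) (ob1 ?G (ob1 ?F Y))"
    note h = hom1[OF X] hom1[OF Y]
    note rF = \<theta>.dom.rmap_rel[OF X Y \<alpha>] and rF' = \<theta>.cod.rmap_rel[OF X Y \<alpha>]
    note r1 = \<psi>.dom.rmap_rel[OF obj(1)[OF X] obj(1)[OF Y] rF]
    note r2 = \<psi>.dom.rmap_rel[OF obj(2)[OF X] obj(2)[OF Y] rF']
    note r3 = \<psi>.cod.rmap_rel[OF obj(2)[OF X] obj(2)[OF Y] rF']
    note r3' = T.reidx_rel[OF hom2[OF X] hom2[OF Y] r3]
    have rS: "reidx S (cpt \<theta> X) (cpt \<theta> Y) (rmap ?F' X Y \<alpha>) \<in> rel S (ob1 ?F X) (ob1 ?F Y)"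
      by (rule relational_doctrine.reidx_rel[OF S \<theta>.cpt_hom[OF X] \<theta>.cpt_hom[OF Y] rF'])
    have "?L (rmap ?G (ob1 ?F X) (ob1 ?F Y) (rmap ?F X Y \<alpha>))
        (reidx T (?G\<theta> X) (?G\<theta> Y) (rmap ?G (ob1 ?F' X) (ob1 ?F' Y) (rmap ?F' X Y \<alpha>)))"
      using \<psi>.dom.rmap_mono[OF obj(1)[OF X] obj(1)[OF Y] rF rS \<theta>.cpt_le[OF X Y \<alpha>]]
        \<psi>.dom.rmap_natural[OF \<theta>.cpt_hom[OF X] \<theta>.cpt_hom[OF Y] rF'] by simp
    moreover have "?L (reidx T (?G\<theta> X) (?G\<theta> Y) (rmap ?G (ob1 ?F' X) (ob1 ?F' Y) (rmap ?F' X Y \<alpha>)))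
        (reidx T (?G\<theta> X) (?G\<theta> Y) (reidx T (?\<psi>F X) (?\<psi>F Y)
          (rmap ?G' (ob1 ?F' X) (ob1 ?F' Y) (rmap ?F' X Y \<alpha>))))"
      by (rule T.reidx_mono[OF h r2 r3' \<psi>.cpt_le[OF obj(2)[OF X] obj(2)[OF Y] rF']])
    ultimately have "?L (rmap ?G (ob1 ?F X) (ob1 ?F Y) (rmap ?F X Y \<alpha>))
        (reidx T (?G\<theta> X) (?G\<theta> Y) (reidx T (?\<psi>F X) (?\<psi>F Y)
          (rmap ?G' (ob1 ?F' X) (ob1 ?F' Y) (rmap ?F' X Y \<alpha>))))"
      by (rule T.le_trans[OF \<psi>.dom.base.fob_obj[OF obj(1)[OF X]] \<psi>.dom.base.fob_obj[OF obj(1)[OF Y]]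
          r1 T.reidx_rel[OF h r2] T.reidx_rel[OF h r3']])
    then show "le T (ob1 (dom1 (hcomp R T \<psi> \<theta>)) X) (ob1 (dom1 (hcomp R T \<psi> \<theta>)) Y)
        (rmap (dom1 (hcomp R T \<psi> \<theta>)) X Y \<alpha>)
        (reidx T (cpt (hcomp R T \<psi> \<theta>) X) (cpt (hcomp R T \<psi> \<theta>) Y)
          (rmap (cod1 (hcomp R T \<psi> \<theta>)) X Y \<alpha>))"
      using X Y \<alpha> by (simp add: T.reidx_cmp[OF hom1[OF X] hom2[OF X] hom1[OF Y] hom2[OF Y] r3])
  qed (simp_all add: comp1_one_arrow[OF R \<theta>.dom1_one_arrow \<psi>.dom1_one_arrow]
      comp1_one_arrow[OF R \<theta>.cod1_one_arrow \<psi>.cod1_one_arrow])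
qed

lemma id1_simps [simp]:
  "X \<in> Ob R \<Longrightarrow> ob1 (id1 R) X = X"
  "f \<in> Hom R X Y \<Longrightarrow> ar1 (id1 R) f = f"
  "\<lbrakk>X \<in> Ob R; Y \<in> Ob R; \<alpha> \<in> rel R X Y\<rbrakk> \<Longrightarrow> rmap (id1 R) X Y \<alpha> = \<alpha>"
  by (auto simp: id1_def rdom_def hom_def)

lemma id1_one_arrow:
  assumes "relational_doctrine R"
  shows "is_one_arrow R R (id1 R)"
proof -
  interpret R: relational_doctrine R by fact
  note [simp] = R.base.ide_hom R.base.cmp_hom R.reidx_rel R.diag_rel R.seq_rel R.conv_rel hom_arr
  have "ob1 (id1 R) \<in> extensional (Ob R)" "ar1 (id1 R) \<in> extensional (arr (base R))"
    "rmap (id1 R) X Y \<in> extensional (rdom R X Y)" for X Y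
    by (simp_all add: id1_def)
  moreover have "ob1 (id1 R) X = X" "ob1 (id1 R) Y = Y" "X \<in> Ob R" "Y \<in> Ob R"
    if "f \<in> Hom R X Y" for f X Y
    using R.base.hom_objs[OF that] by simp_all
  ultimately show ?thesis
    by unfold_locales (simp_all add: id1_simps(2)[OF R.base.ide_hom] id1_simps(2)[OF R.base.cmp_hom])
qed

lemma comp1_id1_left:
  assumes "is_one_arrow R S F"
  shows "comp1 R (id1 S) F = F"
proof -
  interpret F: is_one_arrow R S F by fact
  have "ob1 (comp1 R (id1 S) F) = ob1 F"
    by (rule extensionalityI[OF _ F.ob1_extensional]) (simp_all add: comp1_def id1_def F.base.fob_obj)
  moreover have "ar1 (comp1 R (id1 S) F) = ar1 F"
    by (rule extensionalityI[OF _ F.ar1_extensional])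
      (simp_all add: comp1_def id1_def F.base.far_hom[OF arr_in_hom, THEN hom_arr])
  moreover have "rmap (comp1 R (id1 S) F) X Y = rmap F X Y" for X Y
    by (rule extensionalityI[OF _ F.rmap_extensional])
      (auto simp: comp1_def id1_def rdom_def F.base.fob_obj F.rmap_rel)
  ultimately show ?thesis by (auto intro!: one_arrow.equality cfun.equality)
qed

lemma comp1_id1_right:
  assumes "is_one_arrow R S F"
  shows "comp1 R F (id1 R) = F"
proof -
  interpret F: is_one_arrow R S F by fact
  have "ob1 (comp1 R F (id1 R)) = ob1 F"
    by (rule extensionalityI[OF _ F.ob1_extensional]) (simp_all add: comp1_def id1_def)
  moreover have "ar1 (comp1 R F (id1 R)) = ar1 F"
    by (rule extensionalityI[OF _ F.ar1_extensional]) (simp_all add: comp1_def id1_def)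
  moreover have "rmap (comp1 R F (id1 R)) X Y = rmap F X Y" for X Y
    by (rule extensionalityI[OF _ F.rmap_extensional]) (auto simp: comp1_def id1_def rdom_def)
  ultimately show ?thesis by (auto intro!: one_arrow.equality cfun.equality)
qed

text \<open>
  Composites are restricted to carriers, so the equation needs the intermediate values to lie in the
  carriers of \<open>S\<close>; this holds because \<open>F\<close> is a 1-arrow.
\<close>

lemma comp1_assoc:
  assumes "is_one_arrow R S F"
  shows "comp1 R (comp1 S H G) F = comp1 R H (comp1 R G F)"
proof -
  interpret F: is_one_arrow R S F by fact
  have "rmap (comp1 R (comp1 S H G) F) = rmap (comp1 R H (comp1 R G F))"
    by (auto simp: fun_eq_iff comp1_def restrict_def rdom_def F.base.fob_obj F.rmap_rel)
  moreover have "bfun (comp1 R (comp1 S H G) F) = bfun (comp1 R H (comp1 R G F))"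
    by (auto simp: fun_eq_iff comp1_def restrict_def F.base.fob_obj
        F.base.far_hom[OF arr_in_hom, THEN hom_arr])
  ultimately show ?thesis by simp
qed

lemma hcomp_id2:
  assumes "is_one_arrow R S F" and "is_one_arrow S T G"
  shows "hcomp R T (id2 S T G) (id2 R S F) = id2 R T (comp1 R G F)"
proof -
  interpret F: is_one_arrow R S F by fact
  interpret G: is_one_arrow S T G by fact
  have "cpt (hcomp R T (id2 S T G) (id2 R S F)) = cpt (id2 R T (comp1 R G F))"
    by (auto simp: fun_eq_iff hcomp_def id2_def restrict_def comp1_def F.base.fob_obj
        G.base.far_ide G.base.fob_obj G.base.D.cmp_ide_left[OF G.base.D.ide_hom])
  then show ?thesis by simp
qed

lemma hcomp_assoc:
  assumes "is_two_arrow R S \<theta>" and "is_two_arrow S T \<psi>" and "is_two_arrow T U \<chi>"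
  shows "hcomp R U (hcomp S U \<chi> \<psi>) \<theta> = hcomp R U \<chi> (hcomp R T \<psi> \<theta>)"
proof -
  interpret \<theta>: is_two_arrow R S \<theta> by fact
  interpret \<psi>: is_two_arrow S T \<psi> by fact
  interpret \<chi>: is_two_arrow T U \<chi> by fact
  have "cpt (hcomp R U (hcomp S U \<chi> \<psi>) \<theta>) X = cpt (hcomp R U \<chi> (hcomp R T \<psi> \<theta>)) X" for X
  proof (cases "X \<in> Ob R")
    case True
    note \<theta>X = \<theta>.cpt_hom[OF True]
    note F'X = \<theta>.cod.base.fob_obj[OF True]
    note G\<theta>X = \<psi>.dom.base.far_hom[OF \<theta>X]
    note \<psi>F'X = \<psi>.cpt_hom[OF F'X]
    show ?thesis
      using True F'X hom_arr[OF \<theta>X] \<chi>.dom.base.far_cmp[OF G\<theta>X \<psi>F'X]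
        \<chi>.dom.base.D.cmp_assoc[OF \<chi>.dom.base.far_hom[OF G\<theta>X] \<chi>.dom.base.far_hom[OF \<psi>F'X]
          \<chi>.cpt_hom[OF \<psi>.cod.base.fob_obj[OF F'X]]]
      by simp
  qed (simp add: hcomp_def)
  then show ?thesis
    by (intro two_arrow.equality)
      (auto simp: comp1_assoc[OF \<theta>.dom1_one_arrow] comp1_assoc[OF \<theta>.cod1_one_arrow])
qed

text \<open>
  The interchange law: after reassociating, the two composites differ by a single
  naturality square of \<open>\<psi>\<close> at the component of \<open>\<theta>'\<close>.
\<close>

lemma hcomp_vcomp:
  assumes "is_two_arrow R S \<theta>" and "is_two_arrow R S \<theta>'" and \<theta>\<theta>': "cod1 \<theta> = dom1 \<theta>'"
    and "is_two_arrow S T \<psi>" and "is_two_arrow S T \<psi>'" and \<psi>\<psi>': "cod1 \<psi> = dom1 \<psi>'"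
  shows "hcomp R T (vcomp S T \<psi>' \<psi>) (vcomp R S \<theta>' \<theta>) = vcomp R T (hcomp R T \<psi>' \<theta>') (hcomp R T \<psi> \<theta>)"
proof -
  interpret \<theta>: is_two_arrow R S \<theta> by fact
  interpret \<theta>': is_two_arrow R S \<theta>' by fact
  interpret \<psi>: is_two_arrow S T \<psi> by fact
  interpret \<psi>': is_two_arrow S T \<psi>' by fact
  have "cpt (hcomp R T (vcomp S T \<psi>' \<psi>) (vcomp R S \<theta>' \<theta>)) X
      = cpt (vcomp R T (hcomp R T \<psi>' \<theta>') (hcomp R T \<psi> \<theta>)) X" for X
  proof (cases "X \<in> Ob R")
    case True
    let ?c = "cmp (base T)"
    let ?F' = "ob1 (dom1 \<theta>') X" and ?F'' = "ob1 (cod1 \<theta>') X"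
    note \<theta>X = \<theta>.cpt_hom[OF True, unfolded \<theta>\<theta>'] and \<theta>'X = \<theta>'.cpt_hom[OF True]
    note F' = \<theta>'.dom.base.fob_obj[OF True] and F'' = \<theta>'.cod.base.fob_obj[OF True]
    note G\<theta> = \<psi>.dom.base.far_hom[OF \<theta>X] and G\<theta>' = \<psi>.dom.base.far_hom[OF \<theta>'X]
    note G'\<theta>' = \<psi>'.dom.base.far_hom[OF \<theta>'X]
    note \<psi>F' = \<psi>.cpt_hom[OF F', unfolded \<psi>\<psi>'] and \<psi>F'' = \<psi>.cpt_hom[OF F'', unfolded \<psi>\<psi>']
    note \<psi>'F'' = \<psi>'.cpt_hom[OF F'']
    note assoc = \<psi>.dom.base.D.cmp_assoc and cmp_hom = \<psi>.dom.base.D.cmp_hom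
    have "?c (?c (cpt \<psi>' ?F'') (cpt \<psi> ?F'')) (ar1 (dom1 \<psi>) (cmp (base S) (cpt \<theta>' X) (cpt \<theta> X)))
        = ?c (cpt \<psi>' ?F'') (?c (?c (cpt \<psi> ?F'') (ar1 (dom1 \<psi>) (cpt \<theta>' X))) (ar1 (dom1 \<psi>) (cpt \<theta> X)))"
      using assoc[OF cmp_hom[OF G\<theta> G\<theta>'] \<psi>F'' \<psi>'F''] assoc[OF G\<theta> G\<theta>' \<psi>F'']
        \<psi>.dom.base.far_cmp[OF \<theta>X \<theta>'X] by simp
    also have "\<dots> = ?c (cpt \<psi>' ?F'') (?c (?c (ar1 (dom1 \<psi>') (cpt \<theta>' X)) (cpt \<psi> ?F')) (ar1 (dom1 \<psi>) (cpt \<theta> X)))"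
      using \<psi>.cpt_square[OF \<theta>'X] \<psi>\<psi>' by simp
    also have "\<dots> = ?c (?c (cpt \<psi>' ?F'') (ar1 (dom1 \<psi>') (cpt \<theta>' X)))
        (?c (cpt \<psi> ?F') (ar1 (dom1 \<psi>) (cpt \<theta> X)))"
      using assoc[OF cmp_hom[OF G\<theta> \<psi>F'] G'\<theta>' \<psi>'F''] assoc[OF G\<theta> \<psi>F' G'\<theta>'] by simp
    finally show ?thesis using True F'' \<theta>\<theta>' by simp
  qed (simp add: hcomp_def vcomp_def)
  then show ?thesis by (intro two_arrow.equality) auto
qed

lemma vcomp_id2_id2:
  assumes "is_one_arrow R S F"
  shows "vcomp R S (id2 R S F) (id2 R S F) = id2 R S F"
proof -
  interpret F: is_one_arrow R S F by fact
  show ?thesis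
    by (auto simp: vcomp_def id2_def fun_eq_iff F.base.fob_obj
        F.base.D.cmp_ide_left[OF F.base.D.ide_hom])
qed

text \<open>
  The functor $G \circ - : \mathbf{RD}(R,S) \to \mathbf{RD}(R,T)$ for $G : S \to T$.  With $G$ the
  unit of $S$, the action of the collapse on hom-categories is this functor followed by
  factorization through the unit of $R$.
\<close>

definition postcomp ::
  "('o, 'a, 'r) doctrine \<Rightarrow> ('p, 'b, 's) doctrine \<Rightarrow> ('q, 'c, 't) doctrine
    \<Rightarrow> ('p, 'b, 's, 'q, 'c, 't) one_arrow
    \<Rightarrow> (('o, 'a, 'r, 'p, 'b, 's) one_arrow, ('o, 'a, 'r, 'p, 'b, 's) two_arrow,
        ('o, 'a, 'r, 'q, 'c, 't) one_arrow, ('o, 'a, 'r, 'q, 'c, 't) two_arrow) cfun" where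
  "postcomp R S T G = \<lparr>fob = comp1 R G, far = hcomp R T (id2 S T G)\<rparr>"

text \<open>
  Interchange makes whiskering with a fixed 1-arrow functorial: the whiskering 2-arrow is an
  identity, hence equal to its vertical composite with itself.
\<close>

lemma precomp_functor:
  assumes R: "relational_doctrine R" and R': "relational_doctrine R'" and S: "relational_doctrine S"
    and H: "is_one_arrow R R' H"
  shows "cfunctor (RD R' S) (RD R S) (precomp R R' S H)"
proof -
  note H2 = id2_two_arrow[OF R' H]
  interpret dom: category "RD R' S" by (rule RD_category[OF S])
  interpret cod: category "RD R S" by (rule RD_category[OF S])
  show ?thesis
  proof (standard, goal_cases)
    case 1 then show ?case by (simp add: precomp_def comp1_one_arrow[OF R H])
  next
    case 2 then show ?case by (auto simp: precomp_def hom_def intro!: hcomp_two_arrow R R' S H2)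
  next
    case 3 then show ?case by (simp add: precomp_def hcomp_id2[OF H])
  next
    case (4 \<theta> F G \<psi> K)
    then show ?case
      using hcomp_vcomp[OF H2 H2 _ , of S \<theta> \<psi>] by (simp add: precomp_def hom_def vcomp_id2_id2[OF H])
  qed
qed

lemma postcomp_functor:
  assumes R: "relational_doctrine R" and S: "relational_doctrine S" and T: "relational_doctrine T"
    and G: "is_one_arrow S T G"
  shows "cfunctor (RD R S) (RD R T) (postcomp R S T G)"
proof -
  note G2 = id2_two_arrow[OF T G]
  interpret dom: category "RD R S" by (rule RD_category[OF S])
  interpret cod: category "RD R T" by (rule RD_category[OF T])
  show ?thesis
  proof (standard, goal_cases)
    case 1 then show ?case by (simp add: postcomp_def comp1_one_arrow[OF R _ G])
  next
    case 2 then show ?case by (auto simp: postcomp_def hom_def intro!: hcomp_two_arrow R S T G2)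
  next
    case 3 then show ?case by (simp add: postcomp_def hcomp_id2[OF _ G])
  next
    case (4 \<theta> F F' \<theta>' F'')
    then show ?case
      using hcomp_vcomp[OF _ _ _ G2 G2, of R \<theta> \<theta>'] by (simp add: postcomp_def hom_def vcomp_id2_id2[OF G])
  qed
qed

section \<open>The extensional collapse\<close>

context relational_doctrine
begin

lemma approx_iff:
  "f \<in> Hom R X Y
    \<Longrightarrow> approx R f g \<longleftrightarrow> g \<in> Hom R X Y \<and> le R X X (diag R X) (reidx R f g (diag R Y))"
  by (auto simp: approx_def hom_def)

lemma approx_hom: "\<lbrakk>f \<in> Hom R X Y; approx R f g\<rbrakk> \<Longrightarrow> g \<in> Hom R X Y"
  by (simp add: approx_iff)

lemma approx_refl: "f \<in> Hom R X Y \<Longrightarrow> approx R f f"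
  by (simp add: approx_iff diag_lax)

text \<open>
  The converse of $R_{f,g}(d)$ lies below $R_{g,f}(d)$, and the diagonal is its own converse.
\<close>

lemma approx_sym:
  assumes "approx R f g"
  shows "approx R g f"
proof -
  from assms obtain X Y where f: "f \<in> Hom R X Y" and g: "g \<in> Hom R X Y"
    and le: "le R X X (diag R X) (reidx R f g (diag R Y))" by (auto simp: approx_def)
  from base.hom_objs[OF f] have X: "X \<in> Ob R" and Y: "Y \<in> Ob R" by auto
  note d = diag_rel[OF Y]
  have "le R X X (diag R X) (conv R X X (reidx R f g (diag R Y)))"
    using conv_mono[OF X X diag_rel[OF X] reidx_rel[OF f g d] le] conv_diag[OF X] by simp
  moreover have "le R X X (conv R X X (reidx R f g (diag R Y))) (reidx R g f (diag R Y))"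
    using conv_lax[OF f g d] conv_diag[OF Y] by simp
  ultimately have "le R X X (diag R X) (reidx R g f (diag R Y))"
    by (rule le_trans[OF X X diag_rel[OF X] conv_rel[OF X X reidx_rel[OF f g d]] reidx_rel[OF g f d]])
  with f g show ?thesis by (auto simp: approx_def)
qed

text \<open>
  The key estimate.  The diagonals that may be composed with $R_{f,g}(\alpha)$ on either side are
  replaced by $R_{f',f}(d)$ and $R_{g,g'}(d)$, and lax compatibility of composition with reindexing
  cancels the middle indices \<open>f\<close> and \<open>g\<close>.
\<close>

lemma reidx_approx_le:
  assumes ff': "approx R f f'" and gg': "approx R g g'"
    and f: "f \<in> Hom R X A" and g: "g \<in> Hom R Y B" and \<alpha>: "\<alpha> \<in> rel R A B"
  shows "le R X Y (reidx R f g \<alpha>) (reidx R f' g' \<alpha>)"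
proof -
  note f' = approx_hom[OF f ff'] and g' = approx_hom[OF g gg']
  from base.hom_objs[OF f] have X: "X \<in> Ob R" and A: "A \<in> Ob R" by auto
  from base.hom_objs[OF g] have Y: "Y \<in> Ob R" and B: "B \<in> Ob R" by auto
  note dX = diag_rel[OF X] and dA = diag_rel[OF A] and dY = diag_rel[OF Y] and dB = diag_rel[OF B]
  note \<alpha>fg = reidx_rel[OF f g \<alpha>] and \<alpha>f'g = reidx_rel[OF f' g \<alpha>] and \<alpha>f'g' = reidx_rel[OF f' g' \<alpha>]
  note af = reidx_rel[OF f' f dA] and ag = reidx_rel[OF g g' dB]
  have lef: "le R X X (diag R X) (reidx R f' f (diag R A))"
    using approx_sym[OF ff'] f' by (simp add: approx_iff)
  have leg: "le R Y Y (diag R Y) (reidx R g g' (diag R B))"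
    using gg' g by (simp add: approx_iff)
  have "le R X Y (reidx R f g \<alpha>) (seq R X X Y (reidx R f' f (diag R A)) (reidx R f g \<alpha>))"
    using seq_mono[OF X X Y dX af \<alpha>fg \<alpha>fg lef le_refl[OF X Y \<alpha>fg]] seq_diag_left[OF X Y \<alpha>fg] by simp
  moreover have "le R X Y (seq R X X Y (reidx R f' f (diag R A)) (reidx R f g \<alpha>)) (reidx R f' g \<alpha>)"
    using seq_lax[OF f' f g dA \<alpha>] seq_diag_left[OF A B \<alpha>] by simp
  ultimately have 1: "le R X Y (reidx R f g \<alpha>) (reidx R f' g \<alpha>)"
    by (rule le_trans[OF X Y \<alpha>fg seq_rel[OF X X Y af \<alpha>fg] \<alpha>f'g])
  have "le R X Y (reidx R f' g \<alpha>) (seq R X Y Y (reidx R f' g \<alpha>) (reidx R g g' (diag R B)))"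
    using seq_mono[OF X Y Y \<alpha>f'g \<alpha>f'g dY ag le_refl[OF X Y \<alpha>f'g] leg] seq_diag_right[OF X Y \<alpha>f'g] by simp
  moreover have "le R X Y (seq R X Y Y (reidx R f' g \<alpha>) (reidx R g g' (diag R B))) (reidx R f' g' \<alpha>)"
    using seq_lax[OF f' g g' \<alpha> dB] seq_diag_right[OF A B \<alpha>] by simp
  ultimately have "le R X Y (reidx R f' g \<alpha>) (reidx R f' g' \<alpha>)"
    by (rule le_trans[OF X Y \<alpha>f'g seq_rel[OF X Y Y \<alpha>f'g ag] \<alpha>f'g'])
  with 1 show ?thesis by (rule le_trans[OF X Y \<alpha>fg \<alpha>f'g \<alpha>f'g'])
qed

lemma reidx_approx:
  assumes ff': "approx R f f'" and gg': "approx R g g'"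
    and f: "f \<in> Hom R X A" and g: "g \<in> Hom R Y B" and \<alpha>: "\<alpha> \<in> rel R A B"
  shows "reidx R f' g' \<alpha> = reidx R f g \<alpha>"
proof -
  note f' = approx_hom[OF f ff'] and g' = approx_hom[OF g gg']
  from base.hom_objs[OF f] base.hom_objs[OF g] have X: "X \<in> Ob R" and Y: "Y \<in> Ob R" by auto
  show ?thesis
    by (rule le_antisym[OF X Y reidx_rel[OF f' g' \<alpha>] reidx_rel[OF f g \<alpha>]
          reidx_approx_le[OF approx_sym[OF ff'] approx_sym[OF gg'] f' g' \<alpha>]
          reidx_approx_le[OF ff' gg' f g \<alpha>]])
qed

text \<open>
  If $g \approx h$, replacing \<open>g\<close> by \<open>h\<close> in $R_{f,g}(d)$ changes nothing, so transitivity is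
  an instance of invariance of reindexing.
\<close>

lemma approx_trans:
  assumes fg: "approx R f g" and gh: "approx R g h"
  shows "approx R f h"
proof -
  from fg obtain X Y where f: "f \<in> Hom R X Y"
    and le: "le R X X (diag R X) (reidx R f g (diag R Y))" by (auto simp: approx_def)
  note g = approx_hom[OF f fg]
  from base.hom_objs[OF f] have "Y \<in> Ob R" by auto
  then have "reidx R f h (diag R Y) = reidx R f g (diag R Y)"
    by (intro reidx_approx[OF approx_refl[OF f] gh f g] diag_rel)
  with le f approx_hom[OF g gh] show ?thesis by (simp add: approx_iff)
qed

text \<open>
  $d_X \le R_{f,f'}(d_Y) \le R_{f,f'}(R_{g,g'}(d_Z)) = R_{gf,g'f'}(d_Z)$.
\<close>

lemma approx_cmp:
  assumes ff': "approx R f f'" and gg': "approx R g g'"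
    and f: "f \<in> Hom R X Y" and g: "g \<in> Hom R Y Z"
  shows "approx R (cmp (base R) g f) (cmp (base R) g' f')"
proof -
  note f' = approx_hom[OF f ff'] and g' = approx_hom[OF g gg']
  note gf = base.cmp_hom[OF f g] and gf' = base.cmp_hom[OF f' g']
  from base.hom_objs[OF f] base.hom_objs[OF g]
  have X: "X \<in> Ob R" and Y: "Y \<in> Ob R" and Z: "Z \<in> Ob R" by auto
  note dZ = diag_rel[OF Z] and dY = diag_rel[OF Y]
  have "le R X X (diag R X) (reidx R f f' (diag R Y))"
    using ff' f by (simp add: approx_iff)
  moreover have "le R Y Y (diag R Y) (reidx R g g' (diag R Z))"
    using gg' g by (simp add: approx_iff)
  then have "le R X X (reidx R f f' (diag R Y)) (reidx R f f' (reidx R g g' (diag R Z)))"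
    by (rule reidx_mono[OF f f' dY reidx_rel[OF g g' dZ]])
  ultimately have "le R X X (diag R X) (reidx R f f' (reidx R g g' (diag R Z)))"
    by (rule le_trans[OF X X diag_rel[OF X] reidx_rel[OF f f' dY] reidx_rel[OF f f' reidx_rel[OF g g' dZ]]])
  with gf gf' show ?thesis by (simp add: approx_iff reidx_cmp[OF f g f' g' dZ])
qed

lemma eqcls_eq: "approx R f g \<Longrightarrow> eqcls R f = eqcls R g"
  unfolding eqcls_def by (blast intro: approx_sym approx_trans)

text \<open>
  This lemma and its binary version compute the operations on classes from representatives.
\<close>

lemma the_elem_eqcls:
  assumes "f \<in> Hom R X Y" and "\<And>g. approx R f g \<Longrightarrow> h g = h f"
  shows "the_elem (h ` eqcls R f) = h f"
proof -
  have "h ` eqcls R f = {h f}"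
    using assms approx_refl unfolding eqcls_def by blast
  then show ?thesis by simp
qed

lemma the_elem_eqcls2:
  assumes "f \<in> Hom R X A" and "g \<in> Hom R Y B"
    and "\<And>f' g'. \<lbrakk>approx R f f'; approx R g g'\<rbrakk> \<Longrightarrow> h f' g' = h f g"
  shows "the_elem ((\<lambda>(f, g). h f g) ` (eqcls R f \<times> eqcls R g)) = h f g"
proof -
  have "(\<lambda>(f, g). h f g) ` (eqcls R f \<times> eqcls R g) = {h f g}"
  proof -
    have "(f, g) \<in> eqcls R f \<times> eqcls R g"
      using assms(1,2) by (auto simp: eqcls_def intro: approx_refl)
    moreover have "(case p of (f, g) \<Rightarrow> h f g) = h f g" if "p \<in> eqcls R f \<times> eqcls R g" for p
    proof -
      from that obtain f' g' where "p = (f', g')" "approx R f f'" "approx R g g'"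
        by (auto simp: eqcls_def)
      then show ?thesis using assms(3) by (simp only: prod.case)
    qed
    ultimately show ?thesis by (simp add: image_constant_conv cong: image_cong) blast
  qed
  then show ?thesis by simp
qed

end

lemma quotient_cat_simps [simp]:
  "obj (quotient_cat R) = Ob R"
  "arr (quotient_cat R) = eqcls R ` arr (base R)"
  "ide (quotient_cat R) X = eqcls R (ide (base R) X)"
  by (simp_all add: quotient_cat_def)

lemma collapse_simps [simp]:
  "base (collapse R) = quotient_cat R"
  "rel (collapse R) = rel R"
  "le (collapse R) = le R"
  "diag (collapse R) = diag R"
  "seq (collapse R) = seq R"
  "conv (collapse R) = conv R"
  by (simp_all add: collapse_def)

context relational_doctrine
begin

lemma src_tgt_quotient:
  assumes "f \<in> Hom R X Y"
  shows "src (quotient_cat R) (eqcls R f) = X" and "tgt (quotient_cat R) (eqcls R f) = Y"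
proof -
  have "src (base R) g = src (base R) f" "tgt (base R) g = tgt (base R) f" if "approx R f g" for g
    using that by (auto simp: approx_def hom_def)
  with assms show "src (quotient_cat R) (eqcls R f) = X" "tgt (quotient_cat R) (eqcls R f) = Y"
    by (simp_all add: quotient_cat_def the_elem_eqcls[OF assms]) (simp_all add: hom_def)
qed

lemma hom_quotient: "hom (quotient_cat R) X Y = eqcls R ` Hom R X Y"
  using src_tgt_quotient[OF arr_in_hom] by (auto simp: hom_def[of "quotient_cat R"] hom_def[of "base R"])

lemma cmp_quotient:
  assumes f: "f \<in> Hom R X Y" and g: "g \<in> Hom R Y Z"
  shows "cmp (quotient_cat R) (eqcls R g) (eqcls R f) = eqcls R (cmp (base R) g f)"
  using eqcls_eq[OF approx_cmp[OF _ _ f g]]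
  by (auto simp: quotient_cat_def intro!: the_elem_eqcls2[OF g f])

lemma reidx_collapse:
  assumes f: "f \<in> Hom R X A" and g: "g \<in> Hom R Y B" and \<alpha>: "\<alpha> \<in> rel R A B"
  shows "reidx (collapse R) (eqcls R f) (eqcls R g) \<alpha> = reidx R f g \<alpha>"
  using reidx_approx[OF _ _ f g \<alpha>]
  by (auto simp: collapse_def intro!: the_elem_eqcls2[OF f g])


lemma quotient_category: "category (quotient_cat R)"
proof (standard, goal_cases)
  case 1
  then show ?case
    using src_tgt_quotient[OF arr_in_hom] by (auto simp: base.src_obj)
next
  case 2
  then show ?case
    using src_tgt_quotient[OF arr_in_hom] by (auto simp: base.tgt_obj)
next
  case 3
  then show ?case by (auto simp: hom_quotient base.ide_hom)
next
  case 4
  then show ?case by (auto simp: hom_quotient cmp_quotient base.cmp_hom)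
next
  case (5 c X Y)
  then obtain f where f: "f \<in> Hom R X Y" and c: "c = eqcls R f" by (auto simp: hom_quotient)
  with base.hom_objs[OF f] show ?case
    using cmp_quotient[OF f base.ide_hom] base.cmp_ide_left[OF f] by simp
next
  case (6 c X Y)
  then obtain f where f: "f \<in> Hom R X Y" and c: "c = eqcls R f" by (auto simp: hom_quotient)
  with base.hom_objs[OF f] show ?case
    using cmp_quotient[OF base.ide_hom f] base.cmp_ide_right[OF f] by simp
next
  case (7 c X Y c' Z c'' W)
  then obtain f g h where f: "f \<in> Hom R X Y" and g: "g \<in> Hom R Y Z" and h: "h \<in> Hom R Z W"
    and c: "c = eqcls R f" "c' = eqcls R g" "c'' = eqcls R h" by (auto simp: hom_quotient)
  then show ?case
    using base.cmp_assoc[OF f g h]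
    by (simp add: cmp_quotient[OF f g] cmp_quotient[OF g h] cmp_quotient[OF base.cmp_hom[OF f g] h]
        cmp_quotient[OF f base.cmp_hom[OF g h]])
qed

lemma collapse_doctrine: "relational_doctrine (collapse R)"
proof (rule relational_doctrine.intro, goal_cases)
  case 1
  show ?case using quotient_category by simp
next
  case 2 then show ?case by (simp add: le_refl)
next
  case 3 then show ?case by (simp add: le_antisym)
next
  case 4 then show ?case by simp (blast intro: le_trans)
next
  case 5 then show ?case by (auto simp: hom_quotient reidx_collapse reidx_rel)
next
  case 6 then show ?case by (auto simp: hom_quotient reidx_collapse reidx_mono)
next
  case (7 X Y \<alpha>)
  then show ?case
    using reidx_collapse[OF base.ide_hom base.ide_hom, of X Y \<alpha>] by (simp add: reidx_ide)
next
  case (8 c' X' X c A e' Y' Y e B \<alpha>)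
  then obtain f' f g' g where f': "f' \<in> Hom R X' X" and f: "f \<in> Hom R X A"
    and g': "g' \<in> Hom R Y' Y" and g: "g \<in> Hom R Y B"
    and c: "c' = eqcls R f'" "c = eqcls R f" "e' = eqcls R g'" "e = eqcls R g"
    by (auto simp: hom_quotient)
  from 8 have \<alpha>: "\<alpha> \<in> rel R A B" by simp
  show ?case
    using reidx_cmp[OF f' f g' g \<alpha>]
    by (simp add: c cmp_quotient[OF f' f] cmp_quotient[OF g' g] reidx_collapse[OF f g \<alpha>]
        reidx_collapse[OF f' g' reidx_rel[OF f g \<alpha>]]
        reidx_collapse[OF base.cmp_hom[OF f' f] base.cmp_hom[OF g' g] \<alpha>])
next
  case 9 then show ?case by (simp add: diag_rel)
next
  case (10 c X Y)
  then obtain f where f: "f \<in> Hom R X Y" and c: "c = eqcls R f" by (auto simp: hom_quotient)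
  with base.hom_objs[OF f] show ?case
    using diag_lax[OF f] by (simp add: reidx_collapse[OF f f diag_rel])
next
  case 11 then show ?case by (simp add: seq_rel)
next
  case 12 then show ?case by (simp add: seq_mono)
next
  case (13 c X A e Y B k Z D \<alpha> \<beta>)
  then obtain f g h where f: "f \<in> Hom R X A" and g: "g \<in> Hom R Y B" and h: "h \<in> Hom R Z D"
    and c: "c = eqcls R f" "e = eqcls R g" "k = eqcls R h" by (auto simp: hom_quotient)
  from 13 have \<alpha>: "\<alpha> \<in> rel R A B" and \<beta>: "\<beta> \<in> rel R B D" by simp_all
  have seq: "seq R A B D \<alpha> \<beta> \<in> rel R A D"
    using base.hom_objs[OF f] base.hom_objs[OF g] base.hom_objs[OF h] \<alpha> \<beta> by (simp add: seq_rel)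
  show ?case
    using seq_lax[OF f g h \<alpha> \<beta>]
    by (simp add: c reidx_collapse[OF f g \<alpha>] reidx_collapse[OF g h \<beta>] reidx_collapse[OF f h seq])
next
  case 14 then show ?case by (simp add: conv_rel)
next
  case 15 then show ?case by (simp add: conv_mono)
next
  case (16 c X A e Y B \<alpha>)
  then obtain f g where f: "f \<in> Hom R X A" and g: "g \<in> Hom R Y B"
    and c: "c = eqcls R f" "e = eqcls R g" by (auto simp: hom_quotient)
  from 16 have \<alpha>: "\<alpha> \<in> rel R A B" by simp
  have conv: "conv R A B \<alpha> \<in> rel R B A"
    using base.hom_objs[OF f] base.hom_objs[OF g] \<alpha> by (simp add: conv_rel)
  show ?case
    using conv_lax[OF f g \<alpha>] by (simp add: c reidx_collapse[OF f g \<alpha>] reidx_collapse[OF g f conv])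
next
  case 17 then show ?case by (simp add: seq_assoc)
next
  case 18 then show ?case by (simp add: seq_diag_left)
next
  case 19 then show ?case by (simp add: seq_diag_right)
next
  case 20 then show ?case by (simp add: conv_seq)
next
  case 21 then show ?case by (simp add: conv_diag)
next
  case 22 then show ?case by (simp add: conv_conv)
qed

text \<open>
  The relation $\approx$ of the collapse, tested on representatives, is that of \<open>R\<close>, and
  related representatives have the same class.
\<close>

lemma collapse_extensional: "extensional_doctrine (collapse R)"
proof -
  have "c = c'" if "approx (collapse R) c c'" for c c'
  proof -
    from that obtain X Y f g where f: "f \<in> Hom R X Y" and g: "g \<in> Hom R X Y"
      and c: "c = eqcls R f" "c' = eqcls R g"
      and le: "le R X X (diag R X) (reidx (collapse R) (eqcls R f) (eqcls R g) (diag R Y))"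
      by (auto simp: approx_def[of "collapse R"] hom_quotient)
    from base.hom_objs[OF f] have "Y \<in> Ob R" by auto
    with le f g have "approx R f g" by (simp add: approx_iff reidx_collapse[OF f g diag_rel])
    then show ?thesis by (simp add: c eqcls_eq)
  qed
  then show ?thesis by (simp add: extensional_doctrine_def collapse_doctrine)
qed

section \<open>The universal property of the collapse\<close>

lemma collapse_unit_simps [simp]:
  "X \<in> Ob R \<Longrightarrow> ob1 (collapse_unit R) X = X"
  "f \<in> Hom R X Y \<Longrightarrow> ar1 (collapse_unit R) f = eqcls R f"
  "\<lbrakk>X \<in> Ob R; Y \<in> Ob R; \<alpha> \<in> rel R X Y\<rbrakk> \<Longrightarrow> rmap (collapse_unit R) X Y \<alpha> = \<alpha>"
  by (auto simp: collapse_unit_def rdom_def hom_def)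

lemma collapse_unit_one_arrow: "is_one_arrow R (collapse R) (collapse_unit R)"
proof (rule is_one_arrow.intro, goal_cases)
  case 1
  interpret Q: category "quotient_cat R" by (rule quotient_category)
  show ?case unfolding collapse_simps
  proof (unfold_locales, goal_cases)
    case 1 then show ?case by simp
  next
    case (2 f X Y)
    with base.hom_objs[OF 2] show ?case by (auto simp: hom_quotient)
  next
    case 3 then show ?case by (simp add: collapse_unit_simps(2)[OF base.ide_hom])
  next
    case (4 f X Y g Z)
    then show ?case by (simp add: collapse_unit_simps(2)[OF base.cmp_hom] cmp_quotient)
  qed
next
  case 2 then show ?case by (simp add: collapse_unit_def)
next
  case 3 then show ?case by (simp add: collapse_unit_def)
next
  case 4 then show ?case by (simp add: collapse_unit_def)
next
  case 5 then show ?case by simp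
next
  case 6 then show ?case by simp
next
  case (7 f X A g Y B \<alpha>)
  with base.hom_objs[OF 7(1)] base.hom_objs[OF 7(2)] show ?case
    by (simp add: reidx_rel reidx_collapse)
next
  case 8 then show ?case by (simp add: diag_rel)
next
  case 9 then show ?case by (simp add: seq_rel)
next
  case 10 then show ?case by (simp add: conv_rel)
qed

text \<open>
  $C^R$ is the identity on objects and relations and surjective on arrows, hence epic.
\<close>

lemma one_arrow_collapse_eqI:
  assumes K: "is_one_arrow (collapse R) S K" and K': "is_one_arrow (collapse R) S K'"
    and eq: "comp1 R K (collapse_unit R) = comp1 R K' (collapse_unit R)"
  shows "K = K'"
proof (rule one_arrow_eqI[OF K K'])
  fix X assume "X \<in> Ob (collapse R)"
  then show "ob1 K X = ob1 K' X"
    using arg_cong[OF eq, of "\<lambda>F. ob1 F X"] by simp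
next
  fix c X Y assume "c \<in> Hom (collapse R) X Y"
  then obtain f where f: "f \<in> Hom R X Y" and c: "c = eqcls R f" by (auto simp: hom_quotient)
  show "ar1 K c = ar1 K' c"
    using arg_cong[OF eq, of "\<lambda>F. ar1 F f"] hom_arr[OF f] by (simp add: c collapse_unit_simps(2)[OF f])
next
  fix X Y \<alpha> assume "X \<in> Ob (collapse R)" "Y \<in> Ob (collapse R)" "\<alpha> \<in> rel (collapse R) X Y"
  then show "rmap K X Y \<alpha> = rmap K' X Y \<alpha>"
    using arg_cong[OF eq, of "\<lambda>F. rmap F X Y \<alpha>"] by simp
qed

end

text \<open>
  The factorizations through $C^R$ of 1-arrows and 2-arrows into an extensional doctrine.
\<close>

definition factor1 ::
  "('o, 'a, 'r) doctrine \<Rightarrow> ('o, 'a, 'r, 'p, 'b, 's) one_arrow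
    \<Rightarrow> ('o, 'a set, 'r, 'p, 'b, 's) one_arrow" where
  "factor1 R F =
     \<lparr>bfun = \<lparr>fob = ob1 F, far = (\<lambda>c \<in> arr (quotient_cat R). the_elem (ar1 F ` c))\<rparr>,
      rmap = rmap F\<rparr>"

definition factor2 ::
  "('o, 'a, 'r) doctrine \<Rightarrow> ('o, 'a, 'r, 'p, 'b, 's) two_arrow
    \<Rightarrow> ('o, 'a set, 'r, 'p, 'b, 's) two_arrow" where
  "factor2 R \<theta> = \<lparr>dom1 = factor1 R (dom1 \<theta>), cod1 = factor1 R (cod1 \<theta>), cpt = cpt \<theta>\<rparr>"

lemma factor1_simps [simp]:
  "ob1 (factor1 R F) = ob1 F"
  "rmap (factor1 R F) = rmap F"
  by (simp_all add: factor1_def)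

lemma factor2_simps [simp]:
  "dom1 (factor2 R \<theta>) = factor1 R (dom1 \<theta>)"
  "cod1 (factor2 R \<theta>) = factor1 R (cod1 \<theta>)"
  "cpt (factor2 R \<theta>) = cpt \<theta>"
  by (simp_all add: factor2_def)

text \<open>
  $d_{FX} = \overline F(d_X) \le \overline F(R_{f,g}(d_Y)) = S_{Ff,Fg}(d_{FY})$.
\<close>

lemma (in is_one_arrow) approx_preserved:
  assumes R: "relational_doctrine R" and approx: "approx R f g"
  shows "approx S (ar1 F f) (ar1 F g)"
proof -
  interpret R: relational_doctrine R by fact
  from approx obtain X Y where f: "f \<in> Hom R X Y" and g: "g \<in> Hom R X Y"
    and le: "le R X X (diag R X) (reidx R f g (diag R Y))" by (auto simp: approx_def)
  from base.C.hom_objs[OF f] have X: "X \<in> Ob R" and Y: "Y \<in> Ob R" by auto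
  have "le S (ob1 F X) (ob1 F X) (rmap F X X (diag R X)) (rmap F X X (reidx R f g (diag R Y)))"
    by (rule rmap_mono[OF X X R.diag_rel[OF X] R.reidx_rel[OF f g R.diag_rel[OF Y]] le])
  then have "le S (ob1 F X) (ob1 F X) (diag S (ob1 F X))
      (reidx S (ar1 F f) (ar1 F g) (diag S (ob1 F Y)))"
    by (simp add: rmap_diag[OF X] rmap_diag[OF Y] rmap_natural[OF f g R.diag_rel[OF Y]])
  with base.far_hom[OF f] base.far_hom[OF g] show ?thesis by (auto simp: approx_def)
qed

lemma ar1_factor1:
  assumes R: "relational_doctrine R" and S: "extensional_doctrine S"
    and F: "is_one_arrow R S F" and f: "f \<in> Hom R X Y"
  shows "ar1 (factor1 R F) (eqcls R f) = ar1 F f"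
proof -
  interpret R: relational_doctrine R by fact
  interpret F: is_one_arrow R S F by fact
  have "ar1 F g = ar1 F f" if "approx R f g" for g
    using F.approx_preserved[OF R that] S by (metis extensional_doctrine_def)
  then have "the_elem (ar1 F ` eqcls R f) = ar1 F f" by (rule R.the_elem_eqcls[OF f])
  with f show ?thesis by (simp add: factor1_def hom_def)
qed

lemma factor1_one_arrow:
  assumes R: "relational_doctrine R" and S: "extensional_doctrine S" and F: "is_one_arrow R S F"
  shows "is_one_arrow (collapse R) S (factor1 R F)"
proof -
  interpret R: relational_doctrine R by fact
  interpret F: is_one_arrow R S F by fact
  interpret Q: category "quotient_cat R" by (rule R.quotient_category)
  note ar = ar1_factor1[OF R S F]
  show ?thesis
  proof (rule is_one_arrow.intro, goal_cases)
    case 1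
    show ?case unfolding collapse_simps
    proof (unfold_locales, goal_cases)
      case 1 then show ?case by (simp add: F.base.fob_obj)
    next
      case 2 then show ?case by (auto simp: R.hom_quotient ar F.base.far_hom)
    next
      case 3 then show ?case by (simp add: ar[OF R.base.ide_hom] F.base.far_ide)
    next
      case 4
      then show ?case
        by (auto simp: R.hom_quotient R.cmp_quotient ar ar[OF R.base.cmp_hom] F.base.far_cmp)
    qed
  next
    case 2 then show ?case by (simp add: F.ob1_extensional)
  next
    case 3 then show ?case by (simp add: factor1_def)
  next
    case 4 then show ?case using F.rmap_extensional by (simp add: rdom_def)
  next
    case 5 then show ?case by (simp add: F.rmap_rel)
  next
    case 6 then show ?case by (simp add: F.rmap_mono)
  next
    case 7 then show ?case by (auto simp: R.hom_quotient R.reidx_collapse ar F.rmap_natural)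
  next
    case 8 then show ?case by (simp add: F.rmap_diag)
  next
    case 9 then show ?case by (simp add: F.rmap_seq)
  next
    case 10 then show ?case by (simp add: F.rmap_conv)
  qed
qed

lemma factor2_two_arrow:
  assumes R: "relational_doctrine R" and S: "extensional_doctrine S" and "is_two_arrow R S \<theta>"
  shows "is_two_arrow (collapse R) S (factor2 R \<theta>)"
proof -
  interpret R: relational_doctrine R by fact
  interpret \<theta>: is_two_arrow R S \<theta> by fact
  note dom = \<theta>.dom1_one_arrow and cod = \<theta>.cod1_one_arrow
  show ?thesis
  proof (rule is_two_arrow.intro, goal_cases)
    case 1 then show ?case by (simp add: factor1_one_arrow[OF R S dom])
  next
    case 2 then show ?case by (simp add: factor1_one_arrow[OF R S cod])
  next
    case 3 then show ?case by (simp add: \<theta>.cpt_extensional)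
  next
    case 4
    then show ?case
      by (intro nat_transI) (auto simp: R.hom_quotient \<theta>.cpt_hom ar1_factor1[OF R S dom]
          ar1_factor1[OF R S cod] \<theta>.cpt_square)
  next
    case 5 then show ?case by (simp add: \<theta>.cpt_le)
  qed
qed

lemma comp1_factor1:
  assumes R: "relational_doctrine R" and S: "extensional_doctrine S" and F: "is_one_arrow R S F"
  shows "comp1 R (factor1 R F) (collapse_unit R) = F"
proof -
  interpret R: relational_doctrine R by fact
  note G = factor1_one_arrow[OF R S F]
  show ?thesis
  proof (rule one_arrow_eqI[OF comp1_one_arrow[OF R R.collapse_unit_one_arrow G] F], goal_cases)
    case 1 then show ?case by simp
  next
    case (2 f X Y)
    then show ?case using hom_arr[OF 2] by (simp add: ar1_factor1[OF R S F 2] R.collapse_unit_simps(2)[OF 2])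
  next
    case 3 then show ?case by simp
  qed
qed

lemma factor1_comp1:
  assumes R: "relational_doctrine R" and S: "extensional_doctrine S"
    and K: "is_one_arrow (collapse R) S K"
  shows "factor1 R (comp1 R K (collapse_unit R)) = K"
proof -
  interpret R: relational_doctrine R by fact
  note KC = comp1_one_arrow[OF R R.collapse_unit_one_arrow K]
  show ?thesis
    by (rule R.one_arrow_collapse_eqI[OF factor1_one_arrow[OF R S KC] K comp1_factor1[OF R S KC]])
qed

text \<open>
  Precomposition with $C^R$ leaves the components of a 2-arrow unchanged, which makes factoring
  2-arrows trivial.
\<close>

lemma cpt_precomp_collapse_unit:
  assumes R: "relational_doctrine R" and "is_two_arrow (collapse R) S \<theta>" and X: "X \<in> Ob R"
  shows "cpt (hcomp R S \<theta> (id2 R (collapse R) (collapse_unit R))) X = cpt \<theta> X"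
proof -
  interpret R: relational_doctrine R by fact
  interpret \<theta>: is_two_arrow "collapse R" S \<theta> by fact
  show ?thesis
    using X \<theta>.dom.base.far_ide[of X] \<theta>.dom.base.D.cmp_ide_right[OF \<theta>.cpt_hom[of X]] by simp
qed

lemma hcomp_factor2:
  assumes R: "relational_doctrine R" and S: "extensional_doctrine S" and \<theta>: "is_two_arrow R S \<theta>"
  shows "hcomp R S (factor2 R \<theta>) (id2 R (collapse R) (collapse_unit R)) = \<theta>"
proof -
  interpret R: relational_doctrine R by fact
  interpret \<theta>: is_two_arrow R S \<theta> by fact
  from S have S': "relational_doctrine S" by (simp add: extensional_doctrine_def)
  note C2 = id2_two_arrow[OF R.collapse_doctrine R.collapse_unit_one_arrow]
  note F2 = factor2_two_arrow[OF R S \<theta>]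
  show ?thesis
    by (rule two_arrow_eqI[OF hcomp_two_arrow[OF R R.collapse_doctrine S' C2 F2] \<theta>])
      (simp_all add: comp1_factor1[OF R S \<theta>.dom1_one_arrow] comp1_factor1[OF R S \<theta>.cod1_one_arrow]
        cpt_precomp_collapse_unit[OF R F2] del: hcomp_simps(3))
qed

lemma factor2_hcomp:
  assumes R: "relational_doctrine R" and S: "extensional_doctrine S"
    and \<theta>: "is_two_arrow (collapse R) S \<theta>"
  shows "factor2 R (hcomp R S \<theta> (id2 R (collapse R) (collapse_unit R))) = \<theta>"
proof -
  interpret R: relational_doctrine R by fact
  interpret \<theta>: is_two_arrow "collapse R" S \<theta> by fact
  from S have S': "relational_doctrine S" by (simp add: extensional_doctrine_def)
  note C2 = id2_two_arrow[OF R.collapse_doctrine R.collapse_unit_one_arrow]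
  note F2 = factor2_two_arrow[OF R S hcomp_two_arrow[OF R R.collapse_doctrine S' C2 \<theta>]]
  show ?thesis
    by (rule two_arrow_eqI[OF F2 \<theta>])
      (simp_all add: factor1_comp1[OF R S \<theta>.dom1_one_arrow] factor1_comp1[OF R S \<theta>.cod1_one_arrow]
        cpt_precomp_collapse_unit[OF R \<theta>] del: hcomp_simps(3))
qed

text \<open>
  The counterpart for 2-arrows of \<open>one_arrow_collapse_eqI\<close>: whiskering with $C^R$ has a left
  inverse.
\<close>

lemma two_arrow_collapse_eqI:
  assumes R: "relational_doctrine R" and S: "extensional_doctrine S"
    and \<theta>: "is_two_arrow (collapse R) S \<theta>" and \<theta>': "is_two_arrow (collapse R) S \<theta>'"
    and eq: "hcomp R S \<theta> (id2 R (collapse R) (collapse_unit R))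
      = hcomp R S \<theta>' (id2 R (collapse R) (collapse_unit R))"
  shows "\<theta> = \<theta>'"
  using arg_cong[OF eq, of "factor2 R"] unfolding factor2_hcomp[OF R S \<theta>] factor2_hcomp[OF R S \<theta>'] .

lemma factor_functor:
  assumes R: "relational_doctrine R" and S: "extensional_doctrine S"
  shows "cfunctor (RD R S) (RD (collapse R) S) \<lparr>fob = factor1 R, far = factor2 R\<rparr>"
proof -
  from S have S': "relational_doctrine S" by (simp add: extensional_doctrine_def)
  interpret dom: category "RD R S" by (rule RD_category[OF S'])
  interpret cod: category "RD (collapse R) S" by (rule RD_category[OF S'])
  show ?thesis
  proof (standard, goal_cases)
    case 1 then show ?case by (simp add: factor1_one_arrow[OF R S])
  next
    case 2 then show ?case by (auto simp: hom_def factor2_two_arrow[OF R S])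
  next
    case 3 then show ?case by (simp add: factor2_def id2_def)
  next
    case 4 then show ?case by (simp add: factor2_def vcomp_def)
  qed
qed

lemma precomp_collapse_unit_isomorphism:
  assumes R: "relational_doctrine R" and S: "extensional_doctrine S"
  shows "isomorphism_of_categories (RD (collapse R) S) (RD R S)
    (precomp R (collapse R) S (collapse_unit R))"
proof -
  interpret R: relational_doctrine R by fact
  from S have S': "relational_doctrine S" by (simp add: extensional_doctrine_def)
  show ?thesis
    unfolding isomorphism_of_categories_def
    using precomp_functor[OF R R.collapse_doctrine S' R.collapse_unit_one_arrow]
    by (auto simp: precomp_def comp1_factor1[OF R S] factor1_comp1[OF R S] hcomp_factor2[OF R S]
        factor2_hcomp[OF R S] intro!: exI[of _ "\<lparr>fob = factor1 R, far = factor2 R\<rparr>"]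
        factor_functor[OF R S])
qed

section \<open>The collapse as a 2-functor\<close>

text \<open>
  This identifies $F^e$ with the factor of $C^S \circ F$ through $C^R$.  It transfers the
  universal property of the unit to the collapse.
\<close>

lemma collapse1_eq_factor1:
  assumes R: "relational_doctrine R" and S: "relational_doctrine S" and F: "is_one_arrow R S F"
  shows "collapse1 R S F = factor1 R (comp1 R (collapse_unit S) F)"
proof -
  interpret R: relational_doctrine R by fact
  interpret S: relational_doctrine S by fact
  interpret F: is_one_arrow R S F by fact
  have ob: "ob1 (comp1 R (collapse_unit S) F) = ob1 F"
    by (rule extensionalityI[OF _ F.ob1_extensional])
      (simp_all add: comp1_def F.base.fob_obj)
  have rmap: "rmap (comp1 R (collapse_unit S) F) X Y = rmap F X Y" for X Y
    by (rule extensionalityI[OF _ F.rmap_extensional])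
      (auto simp: comp1_def rdom_def F.base.fob_obj F.rmap_rel)
  have ar: "ar1 (comp1 R (collapse_unit S) F) g = eqcls S (ar1 F g)" if "g \<in> eqcls R f" for f g
  proof -
    from that obtain X Y where g: "g \<in> Hom R X Y" by (auto simp: eqcls_def approx_def)
    show ?thesis
      using hom_arr[OF g] S.collapse_unit_simps(2)[OF F.base.far_hom[OF g]] by simp
  qed
  have "the_elem ((\<lambda>f. eqcls S (ar1 F f)) ` eqcls R f)
      = the_elem (ar1 (comp1 R (collapse_unit S) F) ` eqcls R f)" for f
    using ar by (simp cong: image_cong)
  with ob rmap show ?thesis by (auto simp: collapse1_def factor1_def fun_eq_iff restrict_def)
qed

lemma collapse2_eq_factor2:
  assumes R: "relational_doctrine R" and S: "relational_doctrine S" and "is_two_arrow R S \<theta>"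
  shows "collapse2 R S \<theta> = factor2 R (hcomp R (collapse S) (id2 S (collapse S) (collapse_unit S)) \<theta>)"
proof -
  interpret S: relational_doctrine S by fact
  interpret Q: category "quotient_cat S" by (rule S.quotient_category)
  interpret \<theta>: is_two_arrow R S \<theta> by fact
  have "cpt (collapse2 R S \<theta>) X
      = cpt (hcomp R (collapse S) (id2 S (collapse S) (collapse_unit S)) \<theta>) X" for X
  proof (cases "X \<in> Ob R")
    case True
    note h = \<theta>.cpt_hom[OF True]
    have "eqcls S (cpt \<theta> X) \<in> hom (quotient_cat S) (ob1 (dom1 \<theta>) X) (ob1 (cod1 \<theta>) X)"
      using h by (auto simp: S.hom_quotient)
    from Q.cmp_ide_left[OF this] show ?thesis
      using True \<theta>.cod.base.fob_obj[OF True] by (simp add: collapse2_def S.collapse_unit_simps(2)[OF h])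
  qed (simp add: collapse2_def hcomp_def)
  then show ?thesis
    by (intro two_arrow.equality)
      (auto simp: collapse2_def fun_eq_iff collapse1_eq_factor1[OF R S \<theta>.dom1_one_arrow]
        collapse1_eq_factor1[OF R S \<theta>.cod1_one_arrow])
qed

lemma collapse1_one_arrow:
  assumes R: "relational_doctrine R" and S: "relational_doctrine S" and F: "is_one_arrow R S F"
  shows "is_one_arrow (collapse R) (collapse S) (collapse1 R S F)"
proof -
  interpret S: relational_doctrine S by fact
  show ?thesis unfolding collapse1_eq_factor1[OF R S F]
    by (rule factor1_one_arrow[OF R S.collapse_extensional
          comp1_one_arrow[OF R F S.collapse_unit_one_arrow]])
qed

lemma collapse2_two_arrow:
  assumes R: "relational_doctrine R" and S: "relational_doctrine S" and \<theta>: "is_two_arrow R S \<theta>"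
  shows "is_two_arrow (collapse R) (collapse S) (collapse2 R S \<theta>)"
proof -
  interpret S: relational_doctrine S by fact
  show ?thesis unfolding collapse2_eq_factor2[OF R S \<theta>]
    by (rule factor2_two_arrow[OF R S.collapse_extensional hcomp_two_arrow[OF R S S.collapse_doctrine
            \<theta> id2_two_arrow[OF S.collapse_doctrine S.collapse_unit_one_arrow]]])
qed

lemma collapse_unit_natural1:
  assumes R: "relational_doctrine R" and S: "relational_doctrine S" and F: "is_one_arrow R S F"
  shows "comp1 R (collapse1 R S F) (collapse_unit R) = comp1 R (collapse_unit S) F"
proof -
  interpret S: relational_doctrine S by fact
  show ?thesis unfolding collapse1_eq_factor1[OF R S F]
    by (rule comp1_factor1[OF R S.collapse_extensional comp1_one_arrow[OF R F S.collapse_unit_one_arrow]])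
qed

lemma collapse_unit_natural2:
  assumes R: "relational_doctrine R" and S: "relational_doctrine S" and \<theta>: "is_two_arrow R S \<theta>"
  shows "hcomp R (collapse S) (collapse2 R S \<theta>) (id2 R (collapse R) (collapse_unit R))
    = hcomp R (collapse S) (id2 S (collapse S) (collapse_unit S)) \<theta>"
proof -
  interpret S: relational_doctrine S by fact
  show ?thesis unfolding collapse2_eq_factor2[OF R S \<theta>]
    by (rule hcomp_factor2[OF R S.collapse_extensional hcomp_two_arrow[OF R S S.collapse_doctrine
            \<theta> id2_two_arrow[OF S.collapse_doctrine S.collapse_unit_one_arrow]]])
qed

text \<open>
  Both sides are determined by their composites with $C^R$, and
  $(GF)^e C^R = C^T G F = G^e C^S F = G^e F^e C^R$.
\<close>

lemma collapse1_comp1: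
  assumes R: "relational_doctrine R" and S: "relational_doctrine S" and T: "relational_doctrine T"
    and F: "is_one_arrow R S F" and G: "is_one_arrow S T G"
  shows "collapse1 R T (comp1 R G F) = comp1 (collapse R) (collapse1 S T G) (collapse1 R S F)"
proof -
  interpret R: relational_doctrine R by fact
  interpret S: relational_doctrine S by fact
  note GF = comp1_one_arrow[OF R F G]
  note Fe = collapse1_one_arrow[OF R S F] and Ge = collapse1_one_arrow[OF S T G]
  note CR = R.collapse_unit_one_arrow and CS = S.collapse_unit_one_arrow
  show ?thesis
  proof (rule R.one_arrow_collapse_eqI[OF collapse1_one_arrow[OF R T GF]
        comp1_one_arrow[OF R.collapse_doctrine Fe Ge]])
    have "comp1 R (collapse1 R T (comp1 R G F)) (collapse_unit R)
        = comp1 R (comp1 S (collapse_unit T) G) F"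
      by (simp add: collapse_unit_natural1[OF R T GF] comp1_assoc[OF F])
    also have "\<dots> = comp1 R (comp1 S (collapse1 S T G) (collapse_unit S)) F"
      by (simp add: collapse_unit_natural1[OF S T G])
    also have "\<dots> = comp1 R (collapse1 S T G) (comp1 R (collapse1 R S F) (collapse_unit R))"
      by (simp add: collapse_unit_natural1[OF R S F] comp1_assoc[OF F])
    also have "\<dots> = comp1 R (comp1 (collapse R) (collapse1 S T G) (collapse1 R S F)) (collapse_unit R)"
      by (simp add: comp1_assoc[OF CR])
    finally show "comp1 R (collapse1 R T (comp1 R G F)) (collapse_unit R)
        = comp1 R (comp1 (collapse R) (collapse1 S T G) (collapse1 R S F)) (collapse_unit R)" .
  qed
qed

lemma collapse1_id1:
  assumes R: "relational_doctrine R"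
  shows "collapse1 R R (id1 R) = id1 (collapse R)"
proof -
  interpret R: relational_doctrine R by fact
  note C = R.collapse_unit_one_arrow
  show ?thesis
    by (rule R.one_arrow_collapse_eqI[OF collapse1_one_arrow[OF R R id1_one_arrow[OF R]]
          id1_one_arrow[OF R.collapse_doctrine]])
      (simp add: collapse_unit_natural1[OF R R id1_one_arrow[OF R]] comp1_id1_left[OF C]
        comp1_id1_right[OF C])
qed

lemma collapse2_hcomp:
  assumes R: "relational_doctrine R" and S: "relational_doctrine S" and T: "relational_doctrine T"
    and \<theta>: "is_two_arrow R S \<theta>" and \<psi>: "is_two_arrow S T \<psi>"
  shows "collapse2 R T (hcomp R T \<psi> \<theta>)
    = hcomp (collapse R) (collapse T) (collapse2 S T \<psi>) (collapse2 R S \<theta>)"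
proof -
  interpret R: relational_doctrine R by fact
  interpret S: relational_doctrine S by fact
  interpret T: relational_doctrine T by fact
  note \<psi>\<theta> = hcomp_two_arrow[OF R S T \<theta> \<psi>]
  note \<theta>e = collapse2_two_arrow[OF R S \<theta>] and \<psi>e = collapse2_two_arrow[OF S T \<psi>]
  note CR = id2_two_arrow[OF R.collapse_doctrine R.collapse_unit_one_arrow]
  note CS = id2_two_arrow[OF S.collapse_doctrine S.collapse_unit_one_arrow]
  note CT = id2_two_arrow[OF T.collapse_doctrine T.collapse_unit_one_arrow]
  show ?thesis
  proof (rule two_arrow_collapse_eqI[OF R T.collapse_extensional collapse2_two_arrow[OF R T \<psi>\<theta>]
        hcomp_two_arrow[OF R.collapse_doctrine S.collapse_doctrine T.collapse_doctrine \<theta>e \<psi>e]])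
    let ?h = "hcomp R (collapse T)"
    let ?C = "id2 R (collapse R) (collapse_unit R)"
    have "?h (collapse2 R T (hcomp R T \<psi> \<theta>)) ?C
        = ?h (hcomp S (collapse T) (id2 T (collapse T) (collapse_unit T)) \<psi>) \<theta>"
      by (simp add: collapse_unit_natural2[OF R T \<psi>\<theta>] hcomp_assoc[OF \<theta> \<psi> CT])
    also have "\<dots> = ?h (hcomp S (collapse T) (collapse2 S T \<psi>) (id2 S (collapse S) (collapse_unit S))) \<theta>"
      by (simp add: collapse_unit_natural2[OF S T \<psi>])
    also have "\<dots> = ?h (collapse2 S T \<psi>) (hcomp R (collapse S) (collapse2 R S \<theta>) ?C)"
      by (simp add: collapse_unit_natural2[OF R S \<theta>] hcomp_assoc[OF \<theta> CS \<psi>e])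
    also have "\<dots> = ?h (hcomp (collapse R) (collapse T) (collapse2 S T \<psi>) (collapse2 R S \<theta>)) ?C"
      by (simp add: hcomp_assoc[OF CR \<theta>e \<psi>e])
    finally show "?h (collapse2 R T (hcomp R T \<psi> \<theta>)) ?C
        = ?h (hcomp (collapse R) (collapse T) (collapse2 S T \<psi>) (collapse2 R S \<theta>)) ?C" .
  qed
qed

text \<open>
  On each hom-category the collapse is postcomposition with the unit of \<open>S\<close> followed by
  factorization through the unit of \<open>R\<close>, both of which are functors.
\<close>

lemma E_hom_functor:
  assumes R: "relational_doctrine R" and S: "relational_doctrine S"
  shows "cfunctor (RD R S) (RD (collapse R) (collapse S)) (E_hom R S)"
proof -
  interpret S: relational_doctrine S by fact
  let ?C = "postcomp R S (collapse S) (collapse_unit S)"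
  interpret post: cfunctor "RD R S" "RD R (collapse S)" ?C
    by (rule postcomp_functor[OF R S S.collapse_doctrine S.collapse_unit_one_arrow])
  interpret fac: cfunctor "RD R (collapse S)" "RD (collapse R) (collapse S)"
      "\<lparr>fob = factor1 R, far = factor2 R\<rparr>"
    by (rule factor_functor[OF R S.collapse_extensional])
  have ob: "fob (E_hom R S) F = factor1 R (fob ?C F)" if "F \<in> obj (RD R S)" for F
    using that by (simp add: E_hom_def postcomp_def collapse1_eq_factor1[OF R S])
  have ar: "far (E_hom R S) \<theta> = factor2 R (far ?C \<theta>)" if "\<theta> \<in> arr (RD R S)" for \<theta>
    using that by (simp add: E_hom_def postcomp_def collapse2_eq_factor2[OF R S])
  show ?thesis
  proof (unfold_locales, goal_cases)
    case (1 F)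
    then show ?case using fac.fob_obj[OF post.fob_obj[OF 1]] by (simp only: ob cfun.simps)
  next
    case (2 \<theta> F G)
    with post.C.hom_objs[OF 2] fac.far_hom[OF post.far_hom[OF 2]] show ?case
      by (simp only: ob ar[OF hom_arr] cfun.simps)
  next
    case (3 F)
    with fac.far_ide[OF post.fob_obj[OF 3]] show ?case
      by (simp only: ob ar[OF hom_arr[OF post.C.ide_hom]] cfun.simps post.far_ide)
  next
    case (4 \<theta> F G \<psi> H)
    with fac.far_cmp[OF post.far_hom[OF 4(1)] post.far_hom[OF 4(2)]] show ?case
      by (simp only: ar[OF hom_arr] ar[OF hom_arr[OF post.C.cmp_hom]] cfun.simps post.far_cmp)
  qed
qed

text \<open>
  Replacing $F^e C^R$ by $C^{R'} F$ inside $(G H) F^e C^R$ gives $G (H C^{R'}) F$, up to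
  associativity.
\<close>

lemma precomp_collapse_unit_natural1:
  assumes R: "relational_doctrine R" and R': "relational_doctrine R'"
    and F: "is_one_arrow R R' F"
  shows "comp1 R (comp1 (collapse R) (comp1 (collapse R') G H) (collapse1 R R' F)) (collapse_unit R)
    = comp1 R (comp1 R' G (comp1 R' H (collapse_unit R'))) F"
proof -
  interpret R: relational_doctrine R by fact
  interpret R': relational_doctrine R' by fact
  show ?thesis
    by (simp add: comp1_assoc[OF R.collapse_unit_one_arrow] collapse_unit_natural1[OF R R' F]
        comp1_assoc[OF R'.collapse_unit_one_arrow, symmetric] comp1_assoc[OF F, symmetric])
qed

lemma precomp_collapse_unit_natural2:
  assumes R: "relational_doctrine R" and R': "relational_doctrine R'" and S: "relational_doctrine S"
    and T: "relational_doctrine T"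
    and \<phi>: "is_two_arrow R R' \<phi>" and \<theta>: "is_two_arrow (collapse R') S \<theta>" and \<psi>: "is_two_arrow S T \<psi>"
  shows "hcomp R T (hcomp (collapse R) T (hcomp (collapse R') T \<psi> \<theta>) (collapse2 R R' \<phi>))
        (id2 R (collapse R) (collapse_unit R))
    = hcomp R T (hcomp R' T \<psi> (hcomp R' S \<theta> (id2 R' (collapse R') (collapse_unit R')))) \<phi>"
proof -
  interpret R: relational_doctrine R by fact
  interpret R': relational_doctrine R' by fact
  note C = id2_two_arrow[OF R.collapse_doctrine R.collapse_unit_one_arrow]
  note C' = id2_two_arrow[OF R'.collapse_doctrine R'.collapse_unit_one_arrow]
  note \<psi>\<theta> = hcomp_two_arrow[OF R'.collapse_doctrine S T \<theta> \<psi>]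
  show ?thesis
    by (simp add: hcomp_assoc[OF C collapse2_two_arrow[OF R R' \<phi>] \<psi>\<theta>] collapse_unit_natural2[OF R R' \<phi>]
        hcomp_assoc[OF \<phi> C' \<psi>\<theta>, symmetric] hcomp_assoc[OF C' \<theta> \<psi>])
qed

theorem theorem4p7:
  fixes R :: "('o1, 'a1, 'r1) doctrine"
    and R' :: "('o2, 'a2, 'r2) doctrine"
    and R'' :: "('o3, 'a3, 'r3) doctrine"
    and S :: "('o4, 'a4, 'r4) doctrine"
    and S' :: "('o5, 'a5, 'r5) doctrine"
  assumes "relational_doctrine R" and "relational_doctrine R'" and "relational_doctrine R''"
    and "extensional_doctrine S" and "extensional_doctrine S'"
  shows
    "\<comment> \<open>E is a strict 2-functor from RD to ERD\<close>
     extensional_doctrine (collapse R) \<and>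
     cfunctor (RD R R') (ERD (collapse R) (collapse R')) (E_hom R R') \<and>
     collapse1 R R (id1 R) = id1 (collapse R) \<and>
     (\<forall>F \<in> obj (RD R R'). \<forall>G \<in> obj (RD R' R'').
        collapse1 R R'' (comp1 R G F)
          = comp1 (collapse R) (collapse1 R' R'' G) (collapse1 R R' F)) \<and>
     (\<forall>\<phi> \<in> arr (RD R R'). \<forall>\<psi> \<in> arr (RD R' R'').
        collapse2 R R'' (hcomp R R'' \<psi> \<phi>)
          = hcomp (collapse R) (collapse R'') (collapse2 R' R'' \<psi>) (collapse2 R R' \<phi>)) \<and>
     \<comment> \<open>precomposition with the unit: an equivalence, in fact an isomorphism, of hom-categories\<close>
     collapse_unit R \<in> obj (RD R (collapse R)) \<and>
     equivalence_of_categories (ERD (collapse R) S) (RD R S)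
       (precomp R (collapse R) S (collapse_unit R)) \<and>
     isomorphism_of_categories (ERD (collapse R) S) (RD R S)
       (precomp R (collapse R) S (collapse_unit R)) \<and>
     \<comment> \<open>2-naturality in both variables, on 1-arrows and on 2-arrows\<close>
     (\<forall>F \<in> obj (RD R R'). \<forall>H \<in> obj (ERD (collapse R') S). \<forall>G \<in> obj (ERD S S').
        fob (precomp R (collapse R) S' (collapse_unit R))
            (comp1 (collapse R) (comp1 (collapse R') G H) (collapse1 R R' F))
          = comp1 R (comp1 R' G (fob (precomp R' (collapse R') S (collapse_unit R')) H)) F) \<and>
     (\<forall>\<phi> \<in> arr (RD R R'). \<forall>\<theta> \<in> arr (ERD (collapse R') S). \<forall>\<psi> \<in> arr (ERD S S').
        far (precomp R (collapse R) S' (collapse_unit R))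
            (hcomp (collapse R) S' (hcomp (collapse R') S' \<psi> \<theta>) (collapse2 R R' \<phi>))
          = hcomp R S'
              (hcomp R' S' \<psi> (far (precomp R' (collapse R') S (collapse_unit R')) \<theta>)) \<phi>)"
proof -
  note R = assms(1) and R' = assms(2) and R'' = assms(3) and S = assms(4)
  from assms(4,5) have rS: "relational_doctrine S" and rS': "relational_doctrine S'"
    by (simp_all add: extensional_doctrine_def)
  interpret R: relational_doctrine R by (rule R)
  note iso = precomp_collapse_unit_isomorphism[OF R S]
  have pre: "fob (precomp A B D H) = (\<lambda>F. comp1 A F H)"
      "far (precomp A B D H) = (\<lambda>\<theta>. hcomp A D \<theta> (id2 A B H))" for A B D H
    by (simp_all add: precomp_def)
  show ?thesis
    unfolding ERD_def
    by (intro conjI ballI)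
      (simp_all add: pre R.collapse_extensional E_hom_functor[OF R R'] collapse1_id1[OF R]
        collapse1_comp1[OF R R' R''] collapse2_hcomp[OF R R' R''] R.collapse_unit_one_arrow
        iso isomorphism_imp_equivalence[OF iso]
        precomp_collapse_unit_natural1[OF R R'] precomp_collapse_unit_natural2[OF R R' rS rS'])
qed

end
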